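(* Let $F:U\to\mathbb P^{1,s',t'}$ be a local orthogonal map, where $U\subset\mathbb P^{1,s}$ is a connected open set containing a null point. If $s'\le 2s-2$, then $F$ is either null or quasi-standard. If in addition $t'=0$, then $F$ is either constant or standard.
   Context: Let $r,s,t\ge 0$ be integers with $n=r+s+t>0$. $\mathbb C^{r,s,t}$ denotes $\mathbb C^n$ equipped with the (possibly degenerate, indefinite) Hermitian form $\langle z,w\rangle_{r,s,t}=\sum_{j=1}^{r}z_j\bar w_j-\sum_{j=r+1}^{r+s}z_j\bar w_j$, and $\mathbb P^{r,s,t}$ is its projectivization; $\mathbb P^{r,s}=\mathbb P^{r,s,0}$. A point $[z]$ is null if $\langle z,z\rangle_{r,s,t}=0$; $[z]\perp[w]$ if $\langle z,w\rangle_{r,s,t}=0$. A complex linear subspace $H$ (or $\mathbb PH$) is a null space if the form vanishes identically on $H$. A holomorphic map $F:U\to\mathbb P^{r',s',t'}$ on a connected open set $U$ containing a null point is a local orthogonal map if $F(p)\perp F(q)$ for all $p,q\in U$ with $p\perp q$. $F$ is standard if it is induced by a linear isometry $\mathbb C^{r,s,t}\to\mathbb C^{r',s',t'}$ (a linear map $L$ with $\langle Lu,Lv\rangle_{r',s',t'}=\langle u,v\rangle_{r,s,t}$); null if $F(U)$ is contained in a null space. $F$ is quasi-standard if either $F$ is standard, or there is a decomposition $\mathbb C^{r',s',t'}=A\oplus B$ into nonzero subspaces with $\langle a,b\rangle_{r',s',t'}=0$ for all $a\in A,b\in B$ such that $\pi_A\circ F$ is standard and $\pi_B\circ F$ is null,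 where $\pi_A:\mathbb P^{r',s',t'}\dashrightarrow\mathbb PA$, $\pi_B:\mathbb P^{r',s',t'}\dashrightarrow\mathbb PB$ are induced by the linear projections, and $\mathbb PA,\mathbb PB$ carry the restricted forms. *)

theory Defs
  imports "HOL-Analysis.Analysis"
begin

text \<open>Vectors of C^n are modelled as complex^'k for a finite index type 'k,
  together with an enumeration idx of the coordinates by 0..n-1.
  The Hermitian form of signature (r,s,t): coordinates with index < r count
  positively, those with index in [r, r+s) negatively, the rest (t of them)
  are degenerate.\<close>

definition coord_enum :: "('k::finite \<Rightarrow> nat) \<Rightarrow> nat \<Rightarrow> bool" where
  "coord_enum idx n \<longleftrightarrow> bij_betw idx UNIV {..<n}"

definition herm :: "('k::finite \<Rightarrow> nat) \<Rightarrow> nat \<Rightarrow> nat \<Rightarrow> complex^'k \<Rightarrow> complex^'k \<Rightarrow> complex" where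
  "herm idx r s z w =
     (\<Sum>i\<in>{i. idx i < r}. z$i * cnj (w$i))
   - (\<Sum>i\<in>{i. r \<le> idx i \<and> idx i < r + s}. z$i * cnj (w$i))"

definition csubspace :: "(complex^'k) set \<Rightarrow> bool" where
  "csubspace H \<longleftrightarrow> 0 \<in> H \<and> (\<forall>u\<in>H. \<forall>v\<in>H. u + v \<in> H) \<and> (\<forall>c. \<forall>u\<in>H. c *s u \<in> H)"

definition null_space :: "(complex^'k \<Rightarrow> complex^'k \<Rightarrow> complex) \<Rightarrow> (complex^'k) set \<Rightarrow> bool" where
  "null_space B H \<longleftrightarrow> csubspace H \<and> (\<forall>u\<in>H. \<forall>v\<in>H. B u v = 0)"

definition proj_eq :: "complex^'k \<Rightarrow> complex^'k \<Rightarrow> bool" where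
  "proj_eq x y \<longleftrightarrow> x \<noteq> 0 \<and> y \<noteq> 0 \<and> (\<exists>c. x = c *s y)"

definition holo_on :: "(complex^'a) set \<Rightarrow> (complex^'a \<Rightarrow> complex^'b) \<Rightarrow> bool" where
  "holo_on N g \<longleftrightarrow> (\<forall>z\<in>N. \<exists>L. (g has_derivative L) (at z) \<and> (\<forall>c v. L (c *s v) = c *s L v))"

text \<open>An open set U of projective space is represented by its preimage cone
  (the set of nonzero vectors z with [z] in U). Since the fibres C^* are connected,
  U is open and connected iff the cone is.\<close>
definition proj_domain :: "(complex^'a) set \<Rightarrow> bool" where
  "proj_domain C \<longleftrightarrow> open C \<and> connected C \<and> 0 \<notin> C \<and> (\<forall>z\<in>C. \<forall>c. c \<noteq> 0 \<longrightarrow> c *s z \<in> C)"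

text \<open>A holomorphic map F from U (cone C) into projective space is represented by
  a choice of nonzero representative F z for each z in C, constant on projective
  points, which locally admits holomorphic nowhere-vanishing lifts.\<close>
definition proj_holo :: "(complex^'a) set \<Rightarrow> (complex^'a \<Rightarrow> complex^'b) \<Rightarrow> bool" where
  "proj_holo C F \<longleftrightarrow>
     (\<forall>z\<in>C. F z \<noteq> 0) \<and>
     (\<forall>z\<in>C. \<forall>c. c \<noteq> 0 \<longrightarrow> proj_eq (F (c *s z)) (F z)) \<and>
     (\<forall>p\<in>C. \<exists>N g. open N \<and> p \<in> N \<and> holo_on N g \<and> (\<forall>z\<in>N \<inter> C. proj_eq (F z) (g z)))"

definition local_orthogonal ::
  "(complex^'a \<Rightarrow> complex^'a \<Rightarrow> complex) \<Rightarrow> (complex^'b \<Rightarrow> complex^'b \<Rightarrow> complex)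
    \<Rightarrow> (complex^'a) set \<Rightarrow> (complex^'a \<Rightarrow> complex^'b) \<Rightarrow> bool" where
  "local_orthogonal B B' C F \<longleftrightarrow>
     proj_domain C \<and> (\<exists>z\<in>C. B z z = 0) \<and> proj_holo C F \<and>
     (\<forall>p\<in>C. \<forall>q\<in>C. B p q = 0 \<longrightarrow> B' (F p) (F q) = 0)"

definition lin_isometry ::
  "(complex^'a \<Rightarrow> complex^'a \<Rightarrow> complex) \<Rightarrow> (complex^'b \<Rightarrow> complex^'b \<Rightarrow> complex)
    \<Rightarrow> complex^'a^'b \<Rightarrow> bool" where
  "lin_isometry B B' M \<longleftrightarrow> (\<forall>u v. B' (M *v u) (M *v v) = B u v)"

definition standard_map ::
  "(complex^'a \<Rightarrow> complex^'a \<Rightarrow> complex) \<Rightarrow> (complex^'b \<Rightarrow> complex^'b \<Rightarrow> complex)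
    \<Rightarrow> (complex^'a) set \<Rightarrow> (complex^'a \<Rightarrow> complex^'b) \<Rightarrow> bool" where
  "standard_map B B' C F \<longleftrightarrow>
     (\<exists>M. lin_isometry B B' M \<and> (\<forall>z\<in>C. proj_eq (F z) (M *v z)))"

definition null_map ::
  "(complex^'b \<Rightarrow> complex^'b \<Rightarrow> complex) \<Rightarrow> (complex^'a) set \<Rightarrow> (complex^'a \<Rightarrow> complex^'b) \<Rightarrow> bool" where
  "null_map B' C F \<longleftrightarrow> (\<exists>H. null_space B' H \<and> (\<forall>z\<in>C. F z \<in> H))"

definition constant_map :: "(complex^'a) set \<Rightarrow> (complex^'a \<Rightarrow> complex^'b) \<Rightarrow> bool" where
  "constant_map C F \<longleftrightarrow> (\<forall>z\<in>C. \<forall>w\<in>C. proj_eq (F z) (F w))"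

text \<open>Quasi-standard. W = A (+) B, A, B nonzero complex subspaces, orthogonal.
  pi_A o F (a rational map, defined where the A-component of F is nonzero) is
  standard: it is defined somewhere and agrees with a linear isometry into A
  (A with the restricted form) wherever defined; pi_B o F is null: the
  B-components of F lie in a null subspace of B.\<close>
definition quasi_standard ::
  "(complex^'a \<Rightarrow> complex^'a \<Rightarrow> complex) \<Rightarrow> (complex^'b \<Rightarrow> complex^'b \<Rightarrow> complex)
    \<Rightarrow> (complex^'a) set \<Rightarrow> (complex^'a \<Rightarrow> complex^'b) \<Rightarrow> bool" where
  "quasi_standard B B' C F \<longleftrightarrow> standard_map B B' C F \<or>
     (\<exists>A Bs M H.
        csubspace A \<and> csubspace Bs \<and> A \<noteq> {0} \<and> Bs \<noteq> {0} \<and> A \<inter> Bs = {0} \<and>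
        (\<forall>w. \<exists>a\<in>A. \<exists>b\<in>Bs. w = a + b) \<and>
        (\<forall>a\<in>A. \<forall>b\<in>Bs. B' a b = 0) \<and>
        lin_isometry B B' M \<and> (\<forall>u. M *v u \<in> A) \<and>
        null_space B' H \<and> H \<subseteq> Bs \<and>
        (\<forall>z\<in>C. \<forall>a b. a \<in> A \<longrightarrow> b \<in> Bs \<longrightarrow> F z = a + b \<longrightarrow>
            b \<in> H \<and> (a \<noteq> 0 \<longrightarrow> proj_eq a (M *v z))) \<and>
        (\<exists>z\<in>C. \<exists>a b. a \<in> A \<and> b \<in> Bs \<and> F z = a + b \<and> a \<noteq> 0))"

end

theory Submission
  imports Defs "HOL-Complex_Analysis.Conformal_Mappings"
begin

text \<open>
  Let f be a local lift of F, projected to the nondegenerate part of the target, and let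
  b(x, w) = <f x, f w>; it vanishes whenever <x, w> does. Put n = s + 1; then f takes values in a space
  of dimension s' + 1, which is at most 2n - 3. If b vanishes identically, F is null.

  Otherwise fix a second vector field h with <h x, f w> = 0 for orthogonal x and w in a
  subspace W. If the functionals <f x, .> and <h x, .> are independent on the image of W, passing from W
  to the intersection of W with the orthogonal complement of a generic x lowers the dimension of the
  span of f(W) by at least 2, so that this span has dimension at least 2 dim W - 1. The bound
  2n - 3 therefore forces dependence. For h x = f (x + tau q) and W the complement of q this says that
  b(x, w) b(x', w') = b(x, w') b(x', w) whenever x - x' is proportional to q and w, w' are orthogonal to q;
  for h x = D f_x v and W the whole space it shows that b vanishes only to first order along <x, w> = 0.
  Letting the pair (x0, w') of the first identity tend to an orthogonal pair gives
  b(x, w) = h(w) k(x) <x, w>, after which f / h is linear and isometric up to a real factor; the factor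
  is positive because the target has only one positive square.
\<close>

section \<open>Preliminaries\<close>

text \<open>Where the bound is used up: each cut by a hyperplane costs one dimension in the source
  and at least two in the image, and a plane still has an image of dimension three, whence 2 dim W -
  1. For W the complement of q, of dimension n - 1, this gives 2n - 3, exactly the permitted value;
  a point whose image is not orthogonal to f q supplies the one dimension that exceeds it.

  The obstacle is that everything is local: the hyperplane orthogonal to a generic x may miss the
  small domain altogether, so genericity cannot be imposed freely. An orthogonal pair and a point
  where the functionals are independent are therefore carried along together, and one is moved
  towards the other along a complex line. A holomorphic function of one variable that is nonzero at
  one end of a segment is nonzero at all points near the other end, except perhaps at that end
  itself; so both properties can be had at once. Hence the restrictions to complex lines throughout,
  and the conjugations, which turn the dependence on the second slot of a form into a holomorphic
  one.\<close>

lemma scaleR_eq_smult: "r *\<^sub>R (v :: complex^'n) = complex_of_real r *s v"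
  unfolding vec_eq_iff vector_scaleR_component vector_smult_component
  by (simp add: scaleR_conv_of_real)

lemma norm_smult: "norm (c *s (v :: complex^'n)) = norm c * norm v"
proof -
  have "norm (c *s v) = L2_set (\<lambda>i. norm c * norm (v $ i)) UNIV"
    by (simp add: norm_vec_def norm_mult)
  also have "\<dots> = norm c * norm v"
    by (simp add: norm_vec_def L2_set_right_distrib)
  finally show ?thesis .
qed

interpretation smult: bounded_bilinear "(*s) :: complex \<Rightarrow> complex^'n \<Rightarrow> complex^'n"
proof
  show "\<exists>K. \<forall>a (b :: complex^'n). norm (a *s b) \<le> norm a * norm b * K"
    by (rule exI[of _ 1]) (simp add: norm_smult)
qed (unfold scaleR_eq_smult, simp_all add: vec_eq_iff algebra_simps scaleR_conv_of_real)

lemma csubspace_iff_subspace: "csubspace H \<longleftrightarrow> vec.subspace H"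
  by (auto simp: csubspace_def vec.subspace_def)

text \<open>Zeros accumulating at 0 would force \<open>\<phi>\<close> to vanish on all of
  \<open>S\<close>, against its value at 1. In the applications 0 and 1 parametrize two base points
  on a line, and nonvanishing at the second is moved to points near the first.\<close>

lemma eventually_nonzero_near_0:
  assumes "\<phi> holomorphic_on S" "open S" "connected S" "0 \<in> S" "1 \<in> S" "\<phi> 1 \<noteq> (0::complex)"
  shows "\<forall>\<^sub>F t in at 0. \<phi> t \<noteq> 0"
proof (rule ccontr)
  assume "\<not> ?thesis"
  then have "\<exists>\<^sub>F t in at 0. \<phi> t = 0" by (simp add: frequently_def)
  then have "0 islimpt {t. \<phi> t = 0}"
    by (simp add: islimpt_conv_frequently_at)
  then have "0 islimpt ({t. \<phi> t = 0} \<inter> S)"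
    using assms by (meson islimpt_Int_eventually eventually_at_in_open' islimpt_def inf_sup_aci(1) Int_iff)
  then have "\<phi> 1 = 0"
    using analytic_continuation[OF assms(1-3) Int_lower2 assms(4) _ _ assms(5)] by auto
  with assms(6) show False by simp
qed

text \<open>The quotient of \<open>\<phi>\<close> by \<open>\<psi>\<close> has zero derivative where
  \<open>\<psi>\<close> does not vanish, and the identity theorem carries the resulting
  proportionality across the zeros of \<open>\<psi>\<close>. The product form of the conclusion also
  covers the case in which both values of \<open>\<psi>\<close> are zero.\<close>

lemma wronskian_zero:
  assumes "open S" "connected S"
    and "\<And>t. t \<in> S \<Longrightarrow> (\<phi> has_field_derivative \<phi>' t) (at t)"
    and "\<And>t. t \<in> S \<Longrightarrow> (\<psi> has_field_derivative \<psi>' t) (at t)"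
    and w: "\<And>t. t \<in> S \<Longrightarrow> \<phi> t * \<psi>' t = \<psi> t * \<phi>' t"
    and "a \<in> S" "b \<in> S"
  shows "\<phi> a * \<psi> b = \<phi> b * (\<psi> a :: complex)"
proof -
  have main: "\<phi> s * \<psi> t = \<phi> t * \<psi> s"
    if st: "t \<in> S" "s \<in> S" and nz: "\<psi> t \<noteq> 0"
      and d\<phi>: "\<And>t. t \<in> S \<Longrightarrow> (\<phi> has_field_derivative \<phi>' t) (at t)"
      and d\<psi>: "\<And>t. t \<in> S \<Longrightarrow> (\<psi> has_field_derivative \<psi>' t) (at t)"
      and w: "\<And>t. t \<in> S \<Longrightarrow> \<phi> t * \<psi>' t = \<psi> t * \<phi>' t"
    for s t and \<phi> \<psi> \<phi>' \<psi>' :: "complex \<Rightarrow> complex"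
  proof -
    have hol: "\<phi> holomorphic_on S" "\<psi> holomorphic_on S"
      using assms(1) d\<phi> d\<psi> by (auto simp: holomorphic_on_open)
    have "continuous_on S \<psi>" using hol by (rule_tac holomorphic_on_imp_continuous_on)
    then have "isCont \<psi> t" using st assms(1) by (simp add: continuous_on_eq_continuous_at)
    then obtain d where d: "d > 0" "\<And>y. dist t y < d \<Longrightarrow> \<psi> y \<noteq> 0"
      using nz continuous_at_avoid by blast
    obtain e where e: "e > 0" "ball t e \<subseteq> S" using st assms(1) open_contains_ball by blast
    define r where "r = min d e"
    have r: "r > 0" "\<And>y. y \<in> ball t r \<Longrightarrow> y \<in> S \<and> \<psi> y \<noteq> 0"
      using d e by (auto simp: r_def)
    have "\<exists>c. \<forall>y\<in>ball t r. \<phi> y / \<psi> y = c"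
    proof (rule has_field_derivative_zero_constant)
      fix y assume y: "y \<in> ball t r"
      have "((\<lambda>y. \<phi> y / \<psi> y) has_field_derivative ((\<phi>' y * \<psi> y - \<phi> y * \<psi>' y) / (\<psi> y * \<psi> y))) (at y)"
        using r y d\<phi> d\<psi> by (intro DERIV_divide) auto
      moreover have "\<phi>' y * \<psi> y - \<phi> y * \<psi>' y = 0"
        using w r y by (simp add: mult.commute)
      ultimately show "((\<lambda>y. \<phi> y / \<psi> y) has_field_derivative 0) (at y within ball t r)"
        by (simp add: has_field_derivative_at_within)
    qed auto
    then obtain c where c: "\<And>y. y \<in> ball t r \<Longrightarrow> \<phi> y = c * \<psi> y"
      using r by (metis nonzero_eq_divide_eq)
    have "\<phi> s - c * \<psi> s = 0"
    proof (rule analytic_continuation[of "\<lambda>s. \<phi> s - c * \<psi> s" S "ball t r" t s])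
      show "(\<lambda>s. \<phi> s - c * \<psi> s) holomorphic_on S" by (intro holomorphic_intros hol)
      show "ball t r \<subseteq> S" using r by auto
      show "t islimpt ball t r" using r by (simp add: islimpt_ball)
    qed (use assms st c in auto)
    moreover have "\<phi> t = c * \<psi> t" using c r by auto
    ultimately show ?thesis by simp
  qed
  show ?thesis
  proof (cases "\<psi> b \<noteq> 0")
    case True
    then show ?thesis using main[of b a \<psi> \<phi> \<phi>' \<psi>'] assms by auto
  next
    case False
    note pb = this
    show ?thesis
    proof (cases "\<psi> a = 0")
      case True
      then show ?thesis using pb by simp
    next
      case False
      then show ?thesis using main[of a b \<psi> \<phi> \<phi>' \<psi>'] assms by auto
    qed
  qed
qed

section \<open>Dimension counts by linear functionals\<close>

lemma dim_le_Suc_dim_kernel: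
  fixes W :: "(complex^'n) set"
  assumes W: "vec.subspace W" and l: "Vector_Spaces.linear (*s) (*) l"
  shows "vec.dim W \<le> vec.dim (W \<inter> {w. l w = 0}) + 1"
proof (cases "\<exists>u\<in>W. l u \<noteq> 0")
  case False
  then have "W \<inter> {w. l w = 0} = W" by auto
  then show ?thesis by simp
next
  case True
  then obtain u where u: "u \<in> W" "l u \<noteq> 0" by auto
  interpret l: Vector_Spaces.linear "(*s)" "(*)" l by (rule l)
  have "W \<subseteq> vec.span (insert u (W \<inter> {w. l w = 0}))"
  proof
    fix w assume w: "w \<in> W"
    define w' where "w' = w - (l w / l u) *s u"
    have "w' \<in> W \<inter> {w. l w = 0}"
      using w u W by (simp add: w'_def vec.subspace_diff vec.subspace_scale l.diff l.scale)
    then have "w' + (l w / l u) *s u \<in> vec.span (insert u (W \<inter> {w. l w = 0}))"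
      by (intro vec.span_add vec.span_scale vec.span_base) auto
    then show "w \<in> vec.span (insert u (W \<inter> {w. l w = 0}))" by (simp add: w'_def)
  qed
  then have "vec.dim W \<le> vec.dim (vec.span (insert u (W \<inter> {w. l w = 0})))"
    by (rule vec.dim_subset)
  then have "vec.dim W \<le> vec.dim (insert u (W \<inter> {w. l w = 0}))" by simp
  then show ?thesis by (simp add: vec.dim_insert split: if_splits)
qed

lemma dim_add_1_le:
  fixes X :: "(complex^'m) set"
  assumes "X' \<subseteq> X" "a \<in> X" and l: "Vector_Spaces.linear (*s) (*) l"
    and z: "\<And>x. x \<in> X' \<Longrightarrow> l x = 0" and "l a \<noteq> 0"
  shows "vec.dim X' + 1 \<le> vec.dim X"
proof -
  interpret l: Vector_Spaces.linear "(*s)" "(*)" l by (rule l)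
  have "l x = 0" if "x \<in> vec.span X'" for x
    using that by (induction rule: vec.span_induct_alt) (auto simp: l.zero l.add l.scale z)
  then have "a \<notin> vec.span X'" using assms by auto
  then have "vec.dim (insert a X') = vec.dim X' + 1" by (simp add: vec.dim_insert)
  moreover have "vec.dim (insert a X') \<le> vec.dim X" using assms by (intro vec.dim_subset) auto
  ultimately show ?thesis by simp
qed

text \<open>The determinant condition makes \<open>a\<close> and \<open>a'\<close> independent
  modulo the common kernel of the functionals. The combination \<open>l\<close> in the proof kills
  \<open>a\<close>, and its value at \<open>a'\<close> is that determinant, so \<open>a\<close> and
  \<open>a'\<close> can be adjoined one after the other.\<close>

lemma dim_add_2_le:
  fixes X :: "(complex^'m) set"
  assumes "X' \<subseteq> X" "a \<in> X" "a' \<in> X"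
    and l1: "Vector_Spaces.linear (*s) (*) l1" and l2: "Vector_Spaces.linear (*s) (*) l2"
    and z: "\<And>x. x \<in> X' \<Longrightarrow> l1 x = 0" "\<And>x. x \<in> X' \<Longrightarrow> l2 x = 0"
    and nz: "l1 a * l2 a' - l1 a' * l2 a \<noteq> 0"
  shows "vec.dim X' + 2 \<le> vec.dim X"
proof -
  interpret l1: Vector_Spaces.linear "(*s)" "(*)" l1 by (rule l1)
  interpret l2: Vector_Spaces.linear "(*s)" "(*)" l2 by (rule l2)
  define l where "l x = l1 a * l2 x - l1 x * l2 a" for x
  have lin: "Vector_Spaces.linear (*s) (*) l"
    by unfold_locales (auto simp: l_def l1.add l2.add l1.scale l2.scale algebra_simps)
  have "vec.dim X' + 1 \<le> vec.dim (insert a X')"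
  proof (cases "l1 a = 0")
    case True
    then have "l2 a \<noteq> 0" using nz by auto
    then show ?thesis by (intro dim_add_1_le[OF _ _ l2]) (auto simp: z)
  next
    case False
    then show ?thesis by (intro dim_add_1_le[OF _ _ l1]) (auto simp: z)
  qed
  moreover have "vec.dim (insert a X') + 1 \<le> vec.dim X"
    by (rule dim_add_1_le[OF _ assms(3) lin]) (use assms z nz in \<open>auto simp: l_def\<close>)
  ultimately show ?thesis by simp
qed

section \<open>Holomorphy along complex lines\<close>

lemma open_line: "open \<Omega> \<Longrightarrow> open {t. z + t *s u \<in> (\<Omega> :: (complex^'n) set)}"
  using open_vimage[of \<Omega> "\<lambda>t. z + t *s u"]
    continuous_on_add[OF continuous_on_const smult.continuous_on[OF continuous_on_id continuous_on_const]]
  by (auto simp: vimage_def)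

lemma convex_line: "convex \<Omega> \<Longrightarrow> convex {t. z + t *s u \<in> (\<Omega> :: (complex^'n) set)}"
proof -
  assume c: "convex \<Omega>"
  have "z + (a *\<^sub>R s + b *\<^sub>R t) *s u = a *\<^sub>R (z + s *s u) + b *\<^sub>R (z + t *s u)" if "a + b = 1" for a b s t
  proof -
    have "z = (a + b) *\<^sub>R z" using that by simp
    then have "z = a *\<^sub>R z + b *\<^sub>R z" by (simp only: scaleR_add_left)
    then show ?thesis
      by (simp add: scaleR_add_right smult.add_left smult.scaleR_left algebra_simps)
  qed
  then show ?thesis using c unfolding convex_def by auto
qed

lemma has_field_derivative_line:
  fixes G :: "complex^'n \<Rightarrow> complex"
  assumes "(G has_derivative DG) (at (z + t *s u))" and lin: "\<And>c v. DG (c *s v) = c * DG v"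
  shows "((\<lambda>t. G (z + t *s u)) has_field_derivative DG u) (at t)"
proof -
  have "((\<lambda>t. z + t *s u) has_derivative (\<lambda>h. h *s u)) (at t)"
    by (auto intro!: derivative_eq_intros smult.FDERIV)
  from diff_chain_at[OF this assms(1)]
  have "((\<lambda>t. G (z + t *s u)) has_derivative (\<lambda>h. DG (h *s u))) (at t)"
    by (simp add: o_def)
  then show ?thesis by (simp add: has_field_derivative_def lin mult_commute_abs)
qed

lemma holomorphic_on_line:
  fixes G :: "complex^'n \<Rightarrow> complex"
  assumes "open \<Omega>" "\<And>x. x \<in> \<Omega> \<Longrightarrow> (G has_derivative DG x) (at x)"
    and lin: "\<And>x c v. x \<in> \<Omega> \<Longrightarrow> DG x (c *s v) = c * DG x v"
  shows "(\<lambda>t. G (z + t *s u)) holomorphic_on {t. z + t *s u \<in> \<Omega>}"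
  unfolding holomorphic_on_open[OF open_line[OF assms(1)]]
  using has_field_derivative_line[OF assms(2) lin] by blast

text \<open>Only pointwise complex differentiability is given, so continuity of the derivative has
  to be earned: the Cauchy estimate in the direction \<open>v\<close> bounds a difference of
  derivatives by differences of values of \<open>G\<close>, which are small by uniform continuity on
  a compact ball.\<close>

lemma derivative_continuous:
  fixes G :: "complex^'n \<Rightarrow> complex"
  assumes op: "open \<Omega>" and DG: "\<And>x. x \<in> \<Omega> \<Longrightarrow> (G has_derivative DG x) (at x)"
    and lin: "\<And>x c v. x \<in> \<Omega> \<Longrightarrow> DG x (c *s v) = c * DG x v"
  shows "continuous_on \<Omega> (\<lambda>x. DG x v)"
proof (unfold continuous_on_iff, intro ballI allI impI)
  fix x and e :: real assume x: "x \<in> \<Omega>" and e: "e > 0"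
  obtain R where R: "R > 0" "cball x R \<subseteq> \<Omega>" using op x open_contains_cball by blast
  \<comment> \<open>A displacement by \<open>\<zeta> *s v\<close> with |\<zeta>| at most
    \<open>r\<close> has length at most \<open>R / 2\<close>; the added 1 covers
    \<open>v = 0\<close>.\<close>
  define r where "r = R / (2 * (norm v + 1))"
  have nv: "norm v + 1 > 0" by (smt (verit) norm_ge_zero)
  have r: "r > 0" using R nv by (simp add: r_def)
  have rv: "r * norm v \<le> R / 2"
    using R nv by (simp add: r_def field_simps)
  have inK: "y + \<zeta> *s v \<in> cball x R" if "dist y x \<le> R/2" "norm \<zeta> \<le> r" for y \<zeta>
  proof -
    have "norm (\<zeta> *s v) \<le> r * norm v" using that by (simp add: norm_smult mult_right_mono)
    moreover have "dist x (y + \<zeta> *s v) \<le> dist x y + norm (\<zeta> *s v)"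
      using dist_triangle[of x "y + \<zeta> *s v" y] by (simp add: dist_norm)
    ultimately show ?thesis using that rv by (simp add: dist_commute)
  qed
  have contG: "continuous_on \<Omega> G" using DG
    by (meson continuous_at_imp_continuous_on has_derivative_continuous)
  have "uniformly_continuous_on (cball x R) G"
    using R by (intro compact_uniformly_continuous continuous_on_subset[OF contG]) auto
  then obtain d where d: "d > 0" "\<And>a b. a \<in> cball x R \<Longrightarrow> b \<in> cball x R \<Longrightarrow> dist b a < d \<Longrightarrow> dist (G b) (G a) < e * r / 2"
    unfolding uniformly_continuous_on_def using half_gt_zero[OF mult_pos_pos[OF e r]] by metis
  show "\<exists>d>0. \<forall>x'\<in>\<Omega>. dist x' x < d \<longrightarrow> dist (DG x' v) (DG x v) < e"
  proof (intro exI[of _ "min d (R/2)"] conjI ballI impI)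
    fix y assume y: "dist y x < min d (R/2)"
    define \<psi> where "\<psi> \<zeta> = G (y + \<zeta> *s v) - G (x + \<zeta> *s v)" for \<zeta>
    have iy: "y + \<zeta> *s v \<in> cball x R" "x + \<zeta> *s v \<in> cball x R" if "norm \<zeta> \<le> r" for \<zeta>
      using inK[of y \<zeta>] inK[of x \<zeta>] y R that by auto
    have der: "(\<psi> has_field_derivative (DG (y + \<zeta> *s v) v - DG (x + \<zeta> *s v) v)) (at \<zeta>)" if "norm \<zeta> \<le> r" for \<zeta>
    proof -
      have m: "y + \<zeta> *s v \<in> \<Omega>" "x + \<zeta> *s v \<in> \<Omega>" using iy[OF that] R by blast+
      show ?thesis unfolding \<psi>_def[abs_def]
        by (rule DERIV_diff[OF has_field_derivative_line[OF DG[OF m(1)] lin[OF m(1)]]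
              has_field_derivative_line[OF DG[OF m(2)] lin[OF m(2)]]])
    qed
    have "norm ((deriv ^^ 1) \<psi> 0) \<le> fact 1 * (e * r / 2) / r ^ 1"
    proof (rule Cauchy_inequality)
      have der': "(\<psi> has_field_derivative (DG (y + \<zeta> *s v) v - DG (x + \<zeta> *s v) v)) (at \<zeta>)"
        if "\<zeta> \<in> cball 0 r" for \<zeta>
        using der that by simp
      show "\<psi> holomorphic_on ball 0 r"
        using der' ball_subset_cball by (subst holomorphic_on_open) blast+
      show "continuous_on (cball 0 r) \<psi>"
        using der' by (intro continuous_at_imp_continuous_on ballI DERIV_isCont)
      fix \<zeta> :: complex assume "norm (0 - \<zeta>) = r"
      then have "dist (G (y + \<zeta> *s v)) (G (x + \<zeta> *s v)) < e * r / 2"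
        using iy[of \<zeta>] y by (intro d) auto
      then show "norm (\<psi> \<zeta>) \<le> e * r / 2" by (simp add: \<psi>_def dist_norm)
    qed (use r in simp)
    moreover have "deriv \<psi> 0 = DG y v - DG x v"
      using der[of 0] r by (auto intro: DERIV_imp_deriv)
    ultimately have "norm (DG y v - DG x v) \<le> e / 2" using r by simp
    then show "dist (DG y v) (DG x v) < e" using e by (simp add: dist_norm)
  qed (use d(1) R(1) in simp)
qed

text \<open>The difference quotients in the direction \<open>v\<close> are holomorphic in
  \<open>t\<close> and converge locally uniformly. This is what admits a derivative of the map as
  the second vector field of the dimension count.\<close>

lemma derivative_holomorphic_on_line:
  fixes G :: "complex^'n \<Rightarrow> complex"
  assumes op: "open \<Omega>" and DG: "\<And>x. x \<in> \<Omega> \<Longrightarrow> (G has_derivative DG x) (at x)"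
    and lin: "\<And>x c v. x \<in> \<Omega> \<Longrightarrow> DG x (c *s v) = c * DG x v"
  shows "(\<lambda>t. DG (z + t *s u) v) holomorphic_on {t. z + t *s u \<in> \<Omega>}"
proof -
  have "\<exists>r>0. (\<lambda>t. DG (z + t *s u) v) holomorphic_on ball t0 r" if t0: "z + t0 *s u \<in> \<Omega>" for t0
  proof -
    define x where "x = z + t0 *s u"
    obtain R where R: "R > 0" "cball x R \<subseteq> \<Omega>" using op t0 open_contains_cball x_def by blast
    define r where "r = R / (2 * (norm v + 1))"
    define d where "d = R / (2 * (norm u + 1))"
    have nv: "norm v + 1 > 0" "norm u + 1 > 0" by (smt (verit) norm_ge_zero)+
    have r: "r > 0" "d > 0" using R nv by (simp_all add: r_def d_def)
    have rv: "r * norm v \<le> R / 2" "d * norm u \<le> R / 2"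
      using R nv by (simp_all add: r_def d_def field_simps)
    have inK: "z + t *s u + \<zeta> *s v \<in> cball x R" if "dist t t0 \<le> d" "norm \<zeta> \<le> r" for t \<zeta>
    proof -
      have "norm (\<zeta> *s v) \<le> r * norm v" using that by (simp add: norm_smult mult_right_mono)
      moreover have "norm ((t - t0) *s u) \<le> d * norm u"
        using that unfolding norm_smult by (simp add: mult_right_mono dist_norm)
      moreover have "(z + t *s u + \<zeta> *s v) - x = (t - t0) *s u + \<zeta> *s v"
        by (simp add: x_def smult.diff_left)
      then have "dist x (z + t *s u + \<zeta> *s v) = norm ((t - t0) *s u + \<zeta> *s v)"
        by (metis dist_commute dist_norm)
      ultimately show ?thesis using rv norm_triangle_ineq[of "(t - t0) *s u" "\<zeta> *s v"] by simp
    qed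
    define \<tau> where "\<tau> k = complex_of_real (r / real (Suc k))" for k
    have \<tau>: "norm (\<tau> k) \<le> r" "\<tau> k \<noteq> 0" for k
      using r by (auto simp: \<tau>_def norm_divide divide_le_eq mult_le_cancel_left1 norm_of_real simp del: of_nat_Suc)
    have \<tau>lim: "(\<lambda>k. norm (\<tau> k)) \<longlonglongrightarrow> 0"
    proof -
      have "norm (\<tau> k) = r * inverse (real (Suc k))" for k
        using r by (simp add: \<tau>_def norm_divide divide_inverse norm_mult norm_inverse del: of_nat_Suc of_real_of_nat_eq)
      moreover have "(\<lambda>k. r * inverse (real (Suc k))) \<longlonglongrightarrow> r * 0"
        by (intro tendsto_mult tendsto_const LIMSEQ_inverse_real_of_nat)
      ultimately show ?thesis by simp
    qed
    define q where "q k t = (G (z + t *s u + \<tau> k *s v) - G (z + t *s u)) / \<tau> k" for k t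
    have der: "(q k has_field_derivative ((DG (z + \<tau> k *s v + t *s u) u - DG (z + t *s u) u) / \<tau> k)) (at t)"
      if "t \<in> cball t0 d" for k t
    proof -
      have "z + t *s u + \<tau> k *s v \<in> \<Omega>" "z + t *s u \<in> \<Omega>"
        using inK[of t "\<tau> k"] inK[of t 0] that \<tau> R r by (auto simp: dist_commute)
      then have "((\<lambda>t. (G (z + \<tau> k *s v + t *s u) - G (z + t *s u)) / \<tau> k) has_field_derivative
          ((DG (z + \<tau> k *s v + t *s u) u - DG (z + t *s u) u) / \<tau> k)) (at t)"
        by (intro DERIV_cdivide DERIV_diff has_field_derivative_line DG lin) (auto simp: add_ac)
      then show ?thesis by (simp add: q_def[abs_def] add_ac)
    qed
    have cont: "continuous_on \<Omega> (\<lambda>x. DG x v)" by (rule derivative_continuous[OF op DG lin])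
    have uc: "uniformly_continuous_on (cball x R) (\<lambda>x. DG x v)"
      using cont R by (intro compact_uniformly_continuous continuous_on_subset[OF cont]) auto
    have "uniform_limit (cball t0 d) q (\<lambda>t. DG (z + t *s u) v) sequentially"
    proof (rule uniform_limitI)
      fix e :: real assume e: "e > 0"
      obtain \<delta> where \<delta>: "\<delta> > 0" "\<And>a b. a \<in> cball x R \<Longrightarrow> b \<in> cball x R \<Longrightarrow> dist b a < \<delta> \<Longrightarrow> dist (DG b v) (DG a v) < e / 2"
        using uc e unfolding uniformly_continuous_on_def by (metis half_gt_zero)
      have "(\<lambda>k. norm (\<tau> k) * norm v) \<longlonglongrightarrow> 0 * norm v" by (intro tendsto_mult \<tau>lim tendsto_const)
      then have "\<forall>\<^sub>F k in sequentially. norm (\<tau> k) * norm v < \<delta>"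
        using \<delta>(1) by (intro order_tendstoD(2)) auto
      then show "\<forall>\<^sub>F k in sequentially. \<forall>t\<in>cball t0 d. dist (q k t) (DG (z + t *s u) v) < e"
      proof eventually_elim
        case (elim k)
        show ?case
        proof
          fix t assume t: "t \<in> cball t0 d"
          define y where "y = z + t *s u"
          have iy: "y + \<zeta> *s v \<in> cball x R" if "norm \<zeta> \<le> norm (\<tau> k)" for \<zeta>
            using inK[of t \<zeta>] that \<tau>(1)[of k] t by (auto simp: y_def dist_commute)
          \<comment> \<open>With the linear term removed, the error of the difference quotient is an
            increment of \<open>\<psi>\<close> divided by \<open>\<tau> k\<close>, and the
            derivative of \<open>\<psi>\<close> is small on the disc.\<close>
          define \<psi> where "\<psi> \<zeta> = G (y + \<zeta> *s v) - \<zeta> * DG y v" for \<zeta>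
          have "norm (\<psi> (\<tau> k) - \<psi> 0) \<le> e/2 * norm (\<tau> k - 0)"
          proof (rule field_differentiable_bound[of "cball 0 (norm (\<tau> k))" \<psi> "\<lambda>\<zeta>. DG (y + \<zeta> *s v) v - DG y v"])
            fix \<zeta> :: complex assume \<zeta>: "\<zeta> \<in> cball 0 (norm (\<tau> k))"
            have "(\<psi> has_field_derivative (DG (y + \<zeta> *s v) v - 1 * DG y v)) (at \<zeta>)"
              unfolding \<psi>_def[abs_def] using iy[of \<zeta>] \<zeta> R
              by (intro DERIV_diff has_field_derivative_line DG lin DERIV_cmult_right DERIV_ident) auto
            then show "(\<psi> has_field_derivative (DG (y + \<zeta> *s v) v - DG y v)) (at \<zeta> within cball 0 (norm (\<tau> k)))"
              by (simp add: has_field_derivative_at_within)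
            have "norm \<zeta> * norm v \<le> norm (\<tau> k) * norm v" using \<zeta> by (intro mult_right_mono) auto
            then have "dist (DG (y + \<zeta> *s v) v) (DG y v) < e / 2"
              using iy[of \<zeta>] iy[of 0] \<zeta> elim by (intro \<delta>) (auto simp: norm_smult dist_norm)
            then show "norm (DG (y + \<zeta> *s v) v - DG y v) \<le> e / 2" by (simp add: dist_norm)
          qed auto
          then have "norm ((\<psi> (\<tau> k) - \<psi> 0) / \<tau> k) \<le> e / 2"
            using \<tau>(2)[of k] by (simp add: norm_divide divide_le_eq)
          moreover have "(\<psi> (\<tau> k) - \<psi> 0) / \<tau> k = q k t - DG y v"
            using \<tau>(2)[of k] by (simp add: \<psi>_def q_def y_def field_simps)
          ultimately show "dist (q k t) (DG (z + t *s u) v) < e"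
            using e by (simp add: dist_norm y_def)
        qed
      qed
    qed
    then have "(\<lambda>t. DG (z + t *s u) v) holomorphic_on ball t0 d"
    proof (rule holomorphic_uniform_limit[rotated])
      show "\<forall>\<^sub>F k in sequentially. continuous_on (cball t0 d) (q k) \<and> q k holomorphic_on ball t0 d"
      proof (intro always_eventually allI conjI)
        show "continuous_on (cball t0 d) (q k)" for k
          using der by (intro continuous_at_imp_continuous_on ballI DERIV_isCont)
        show "q k holomorphic_on ball t0 d" for k
          using der ball_subset_cball by (subst holomorphic_on_open) blast+
      qed
    qed auto
    then show ?thesis using r by auto
  qed
  then have "(\<lambda>t. DG (z + t *s u) v) field_differentiable at t" if "z + t *s u \<in> \<Omega>" for t
    using that by (metis centre_in_ball holomorphic_on_imp_differentiable_at open_ball)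
  then show ?thesis by (simp add: holomorphic_on_def field_differentiable_at_within)
qed

section \<open>Sesquilinear forms and the dimension of images of flags\<close>

lemmas [tendsto_intros] = smult.tendsto

lemma line_tendsto: "((\<lambda>t. z + t *s (u :: complex^'n)) \<longlongrightarrow> z) (at 0)"
proof -
  have "((\<lambda>t. z + t *s u) \<longlongrightarrow> z + 0 *s u) (at 0)" by (intro tendsto_intros)
  then show ?thesis by simp
qed

text \<open>Any \<open>w\<close> is joined to \<open>a\<close> by a complex line that meets the
  convex domain in a connected open set, so the identity theorem in one variable is enough.\<close>

lemma identity_on_convex:
  fixes G :: "complex^'n \<Rightarrow> complex"
  assumes "open \<Omega>" "convex \<Omega>"
    and G: "\<And>z u. (\<lambda>t. G (z + t *s u)) holomorphic_on {t. z + t *s u \<in> \<Omega>}"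
    and S: "open S" "a \<in> S" "a \<in> \<Omega>" "\<And>w. w \<in> S \<Longrightarrow> w \<in> \<Omega> \<Longrightarrow> G w = 0"
    and w: "w \<in> \<Omega>"
  shows "G w = 0"
proof (rule ccontr)
  assume "G w \<noteq> 0"
  define d where "d = w - a"
  have "\<forall>\<^sub>F t in at 0. G (a + t *s d) \<noteq> 0"
    by (rule eventually_nonzero_near_0[OF G open_line[OF assms(1)] convex_connected[OF convex_line[OF assms(2)]]])
      (use S w \<open>G w \<noteq> 0\<close> in \<open>auto simp: d_def\<close>)
  moreover have "\<forall>\<^sub>F t in at 0. a + t *s d \<in> S \<inter> \<Omega>"
    using S assms(1) by (intro topological_tendstoD[OF line_tendsto]) auto
  ultimately have "\<forall>\<^sub>F t in at (0::complex). False" by eventually_elim (use S in auto)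
  then show False by simp
qed

text \<open>Real bounded bilinearity gives the limit and derivative rules. Complex homogeneity is
  postulated in the first slot alone; hermitian symmetry turns it into conjugate homogeneity in the
  second.\<close>

locale sesq =
  fixes B :: "complex^'k \<Rightarrow> complex^'k \<Rightarrow> complex"
  assumes bilinear: "bounded_bilinear B"
    and scale_left: "B (c *s x) y = c * B x y"
    and herm_sym: "B y x = cnj (B x y)"
begin

sublocale bil: bounded_bilinear B by (rule bilinear)

lemma scale_right: "B x (c *s y) = cnj c * B x y"
  by (metis complex_cnj_mult herm_sym scale_left)

lemma linear_left: "Vector_Spaces.linear (*s) (*) (\<lambda>x. B x y)"
  by unfold_locales (simp_all add: bil.add_left scale_left)

lemmas expand = bil.add_left bil.add_right bil.diff_left bil.diff_right scale_left scale_right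

lemma zero_iff_sym: "B x y = 0 \<longleftrightarrow> B y x = 0"
  by (metis herm_sym complex_cnj_zero_iff)

lemma has_derivative_left:
  "(f has_derivative D) (at x) \<Longrightarrow> ((\<lambda>x. B (f x) y) has_derivative (\<lambda>v. B (D v) y)) (at x)"
  by (rule bounded_linear.has_derivative[OF bil.bounded_linear_left])

end

locale nondegenerate_sesq = sesq +
  assumes nondegenerate: "(\<And>y. B x y = 0) \<Longrightarrow> x = 0"
begin

lemma dual_vector:
  assumes "w \<noteq> 0" shows "\<exists>y. B y w = 1"
proof -
  obtain y where "B w y \<noteq> 0" using nondegenerate assms by blast
  then have "B y w \<noteq> 0" using zero_iff_sym by blast
  then have "B ((1 / B y w) *s y) w = 1" by (simp add: scale_left)
  then show ?thesis by blast
qed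

text \<open>If all vectors orthogonal to \<open>w\<close> were orthogonal to \<open>u\<close>,
  nondegeneracy would make \<open>u\<close> a multiple of \<open>w\<close>. Such dual vectors serve
  to correct a point so that prescribed orthogonality relations hold.\<close>

lemma dual_vector_pair:
  assumes "u \<notin> vec.span {w}" shows "\<exists>y. B y w = 0 \<and> B y u = 1"
proof (cases "w = 0")
  case True
  have "u \<noteq> 0" using assms vec.span_zero by blast
  then show ?thesis using dual_vector[of u] True by (auto simp: bil.zero_right)
next
  case False
  then obtain y0 where y0: "B y0 w = 1" using dual_vector by blast
  have "\<exists>y. B y w = 0 \<and> B y u \<noteq> 0"
  proof (rule ccontr)
    assume *: "\<not> ?thesis"
    have "B (u - cnj (B y0 u) *s w) y = 0" for y
    proof -
      have "B (y - B y w *s y0) w = 0" by (simp add: expand y0)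
      then have "B (y - B y w *s y0) u = 0" using * by blast
      then have "B y (u - cnj (B y0 u) *s w) = 0" by (simp add: expand)
      then show ?thesis using zero_iff_sym by blast
    qed
    then have "u - cnj (B y0 u) *s w = 0" by (rule nondegenerate)
    then have "u = cnj (B y0 u) *s w" by simp
    then show False using assms by (metis vec.span_base vec.span_scale singletonI)
  qed
  then obtain y where "B y w = 0" "B y u \<noteq> 0" by blast
  then show ?thesis by (intro exI[of _ "(1 / B y u) *s y"]) (simp add: scale_left)
qed

end

text \<open>The target form may have a radical, so nondegeneracy is asked of the source
  alone.\<close>

locale two_forms = src: nondegenerate_sesq B + tgt: sesq B'
  for B :: "complex^'n \<Rightarrow> complex^'n \<Rightarrow> complex" and B' :: "complex^'m \<Rightarrow> complex^'m \<Rightarrow> complex"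
begin

section \<open>Growth of the image dimension under hyperplane cuts\<close>

lemma not_in_span_singleton:
  assumes "2 \<le> vec.dim W" shows "\<exists>u\<in>W. u \<notin> vec.span {w :: complex^'n}"
proof (rule ccontr)
  assume "\<not> ?thesis"
  then have "W \<subseteq> vec.span {w}" by blast
  then have "vec.dim W \<le> vec.dim {w}" using vec.dim_subset[of W "vec.span {w}"] by (simp only: vec.dim_span)
  also have "\<dots> \<le> card {w}" by (rule vec.dim_le_card') simp
  finally show False using assms by simp
qed

text \<open>A small shift of \<open>w\<close> inside \<open>W\<close> out of its own line stays in
  the open set. The two points are linearly independent; both forms of this are recorded because a
  dual pair requires one for each point.\<close>

lemma orthogonal_pair_in:
  assumes W: "vec.subspace W" and "2 \<le> vec.dim W" "open \<Omega>" "w \<in> W \<inter> \<Omega>" "w \<noteq> 0"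
  obtains w' where "w' \<in> W \<inter> \<Omega>" "w' \<notin> vec.span {w}" "w \<notin> vec.span {w' :: complex^'n}"
proof -
  obtain u where u: "u \<in> W" "u \<notin> vec.span {w}" using not_in_span_singleton assms by blast
  have "\<forall>\<^sub>F t in at 0. w + t *s u \<in> \<Omega>"
    using line_tendsto assms by (intro topological_tendstoD[of _ w]) auto
  moreover have "\<forall>\<^sub>F t in at (0::complex). t \<noteq> 0" by (simp add: eventually_at_filter)
  ultimately have "\<forall>\<^sub>F t in at 0. w + t *s u \<in> \<Omega> \<and> t \<noteq> 0" by eventually_elim simp
  then obtain t where t: "w + t *s u \<in> \<Omega>" "t \<noteq> 0" using eventually_happens by fastforce
  define w' where "w' = w + t *s u"
  have n1: "w' \<notin> vec.span {w}"
  proof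
    assume "w' \<in> vec.span {w}"
    then have "(1/t) *s (w' - w) \<in> vec.span {w}"
      by (rule vec.span_scale[OF vec.span_diff[OF _ vec.span_base]]) simp
    then show False using u t by (simp add: w'_def)
  qed
  have "w \<notin> vec.span {w'}"
  proof
    assume "w \<in> vec.span {w'}"
    then obtain c where c: "w = c *s w'" by (auto simp: vec.span_singleton)
    then have "c \<noteq> 0" using assms by auto
    then have "w' = (1/c) *s w" using c by simp
    then show False using n1 by (metis vec.span_base vec.span_scale singletonI)
  qed
  moreover have "w' \<in> W \<inter> \<Omega>" using assms u t by (auto simp: w'_def vec.subspace_add vec.subspace_scale)
  ultimately show ?thesis using that n1 by blast
qed

text \<open>\<open>e x w w'\<close> is the determinant of the functionals <., f x> and <., h x> at
  \<open>f w\<close> and \<open>f w'\<close>. The assumption \<open>inc\<close> keeps a hyperplane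
  orthogonal to some point of \<open>X\<close> in contact with \<open>\<Omega>\<close>, and
  \<open>bad\<close> keeps the functionals independent; the induction has to hand both to the
  smaller subspace. \<open>W0\<close> is the fixed subspace on whose points orthogonality to
  \<open>x\<close> also controls \<open>h x\<close>.\<close>

lemma flag_dimension:
  fixes f h :: "complex^'n \<Rightarrow> complex^'m" and \<Omega> X :: "(complex^'n) set"
  defines "e \<equiv> \<lambda>x w w'. B' (f w) (f x) * B' (f w') (h x) - B' (f w') (f x) * B' (f w) (h x)"
  assumes \<Omega>: "open \<Omega>" "convex \<Omega>" "0 \<notin> \<Omega>"
    and X: "open X" "convex X" "X \<subseteq> \<Omega>"
    and f_hol: "\<And>z u y. (\<lambda>t. B' (f (z + t *s u)) y) holomorphic_on {t. z + t *s u \<in> \<Omega>}"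
    and h_hol: "\<And>z u y. (\<lambda>t. B' (h (z + t *s u)) y) holomorphic_on {t. z + t *s u \<in> X}"
    and f_cont: "continuous_on \<Omega> f" and h_cont: "continuous_on X h"
    and orth: "\<And>x w. x \<in> X \<Longrightarrow> w \<in> \<Omega> \<Longrightarrow> w \<in> W0 \<Longrightarrow> B x w = 0 \<Longrightarrow>
                  B' (f w) (f x) = 0 \<and> B' (f w) (h x) = 0"
    and W: "vec.subspace W" "W \<subseteq> W0" "k + 2 \<le> vec.dim W"
    and inc: "w0 \<in> W" "w0 \<in> \<Omega>" "x0 \<in> X" "B x0 w0 = 0"
    and bad: "xs \<in> X" "ws \<in> W" "ws \<in> \<Omega>" "ws' \<in> W" "ws' \<in> \<Omega>" "e xs ws ws' \<noteq> 0"
  shows "2 * k + 3 \<le> vec.dim (f ` (W \<inter> \<Omega>))"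
  using W inc bad
proof (induction k arbitrary: W w0 x0 xs ws ws')
  \<comment> \<open>\<open>e\<close> is antiholomorphic in its first argument, so its conjugate is
    taken along the line from \<open>x0\<close> to \<open>xs\<close>.\<close>
  have e_x: "\<forall>\<^sub>F t in at 0. e (x0 + t *s (xs - x0)) ws ws' \<noteq> 0"
    if "x0 \<in> X" "xs \<in> X" "e xs ws ws' \<noteq> 0" for x0 xs ws ws'
  proof -
    define d where "d = xs - x0"
    have d: "xs = x0 + 1 *s d" by (simp add: d_def)
    have sub: "{t. x0 + t *s d \<in> X} \<subseteq> {t. x0 + t *s d \<in> \<Omega>}" using X by auto
    have "\<forall>\<^sub>F t in at 0. cnj (e (x0 + t *s d) ws ws') \<noteq> 0"
    proof (rule eventually_nonzero_near_0)
      have "(\<lambda>t. cnj (e (x0 + t *s d) ws ws')) =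
          (\<lambda>t. B' (f (x0 + t *s d)) (f ws) * B' (h (x0 + t *s d)) (f ws')
             - B' (f (x0 + t *s d)) (f ws') * B' (h (x0 + t *s d)) (f ws))"
        by (simp add: e_def tgt.herm_sym[symmetric])
      then show "(\<lambda>t. cnj (e (x0 + t *s d) ws ws')) holomorphic_on {t. x0 + t *s d \<in> X}"
        by (auto intro!: holomorphic_intros h_hol holomorphic_on_subset[OF f_hol sub])
      show "cnj (e (x0 + 1 *s d) ws ws') \<noteq> 0" using that d by simp
    qed (use that X d in \<open>auto intro!: open_line convex_connected convex_line\<close>)
    then have "\<forall>\<^sub>F t in at 0. e (x0 + t *s d) ws ws' \<noteq> 0" by simp
    then show ?thesis unfolding d_def .
  qed
  have e_tendsto: "\<forall>\<^sub>F t in F. x t \<in> X \<and> e (x t) ws ws' \<noteq> 0"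
    if "x1 \<in> X" "e x1 ws ws' \<noteq> 0" "(x \<longlongrightarrow> x1) F" for x1 x ws ws' and F :: "complex filter"
  proof -
    have 1: "\<forall>\<^sub>F t in F. x t \<in> X" using that X by (intro topological_tendstoD) auto
    then have 2: "\<forall>\<^sub>F t in F. x t \<in> \<Omega>" by eventually_elim (use X in auto)
    have "((\<lambda>t. e (x t) ws ws') \<longlongrightarrow> e x1 ws ws') F"
      unfolding e_def using that X 1 2
      by (intro tendsto_intros tgt.bil.tendsto continuous_on_tendsto_compose[OF f_cont]
            continuous_on_tendsto_compose[OF h_cont]) auto
    then have "\<forall>\<^sub>F t in F. e (x t) ws ws' \<noteq> 0" using that by (intro tendsto_imp_eventually_ne)
    with 1 show ?thesis by eventually_elim simp
  qed
  \<comment> \<open>An orthogonal pair with independent functionals: \<open>x\<close> moves towards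
    \<open>xs\<close> while \<open>w\<close> is corrected along \<open>u\<close> to remain
    orthogonal to it. The preliminary shift of \<open>x0\<close> along \<open>y\<close> keeps
    \<open>w0\<close> orthogonal and makes the denominator \<open>B u (x t)\<close> nonzero near the
    start.\<close>
  have start: "\<exists>x1 w1. x1 \<in> X \<and> w1 \<in> W \<inter> \<Omega> \<and> B x1 w1 = 0 \<and> e x1 ws ws' \<noteq> 0"
    if W: "vec.subspace W" "2 \<le> vec.dim W" and "w0 \<in> W" "w0 \<in> \<Omega>" "x0 \<in> X" "B x0 w0 = 0"
      and "xs \<in> X" "e xs ws ws' \<noteq> 0" for W w0 x0 xs ws ws'
  proof -
    obtain u where u: "u \<in> W" "u \<notin> vec.span {w0}" using not_in_span_singleton W by blast
    then obtain y where y: "B y w0 = 0" "B y u = 1" using src.dual_vector_pair by blast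
    have "\<forall>\<^sub>F t in at 0. x0 + t *s y \<in> X"
      using that X by (intro topological_tendstoD[OF line_tendsto]) auto
    moreover have "\<forall>\<^sub>F t in at 0. B x0 u + t \<noteq> 0"
    proof (cases "B x0 u = 0")
      case True then show ?thesis by (simp add: eventually_at_filter)
    next
      case False
      have "((\<lambda>t. B x0 u + t) \<longlongrightarrow> B x0 u + 0) (at 0)" by (intro tendsto_intros)
      then show ?thesis using False by (intro tendsto_imp_eventually_ne) auto
    qed
    ultimately have "\<forall>\<^sub>F t in at 0. x0 + t *s y \<in> X \<and> B x0 u + t \<noteq> 0" by eventually_elim simp
    then obtain t0 where t0: "x0 + t0 *s y \<in> X" "B x0 u + t0 \<noteq> 0" using eventually_happens by fastforce
    define x0' where "x0' = x0 + t0 *s y"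
    have x0': "x0' \<in> X" "B u x0' \<noteq> 0" "B w0 x0' = 0"
      using t0 y that src.zero_iff_sym by (auto simp: x0'_def src.expand)
        (metis mult.right_neutral src.bil.add_left src.scale_left src.zero_iff_sym y(2) src.bil.add_right src.scale_right)+
    define x where "x t = x0' + t *s (xs - x0')" for t
    define w where "w t = w0 - (B w0 (x t) / B u (x t)) *s u" for t
    have xt: "(x \<longlongrightarrow> x0') (at 0)" unfolding x_def[abs_def] by (rule line_tendsto)
    have but: "((\<lambda>t. B u (x t)) \<longlongrightarrow> B u x0') (at 0)"
      by (intro src.bil.tendsto xt tendsto_intros)
    have "(w \<longlongrightarrow> w0 - (B w0 x0' / B u x0') *s u) (at 0)"
      unfolding w_def[abs_def] by (intro tendsto_intros src.bil.tendsto xt x0')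
    then have wt: "(w \<longlongrightarrow> w0) (at 0)" by (simp add: x0')
    have "\<forall>\<^sub>F t in at 0. w t \<in> \<Omega>" using that \<Omega> by (intro topological_tendstoD[OF wt]) auto
    moreover have "\<forall>\<^sub>F t in at 0. x t \<in> X" using x0' X by (intro topological_tendstoD[OF xt]) auto
    moreover have "\<forall>\<^sub>F t in at 0. B u (x t) \<noteq> 0" using but x0' by (intro tendsto_imp_eventually_ne)
    moreover have "\<forall>\<^sub>F t in at 0. e (x t) ws ws' \<noteq> 0"
      unfolding x_def using that x0' by (intro e_x) auto
    ultimately have "\<forall>\<^sub>F t in at 0. w t \<in> \<Omega> \<and> x t \<in> X \<and> B u (x t) \<noteq> 0 \<and> e (x t) ws ws' \<noteq> 0"
      by eventually_elim simp
    then obtain t where t: "w t \<in> \<Omega>" "x t \<in> X" "B u (x t) \<noteq> 0" "e (x t) ws ws' \<noteq> 0"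
      using eventually_happens by fastforce
    have "B (w t) (x t) = 0" using t by (simp add: w_def src.expand)
    then have "B (x t) (w t) = 0" using src.zero_iff_sym by blast
    moreover have "w t \<in> W" using W that u by (simp add: w_def vec.subspace_diff vec.subspace_scale)
    ultimately show ?thesis using t by blast
  qed
  have lin2: "vec.dim (f ` (W' \<inter> \<Omega>)) + 2 \<le> vec.dim (f ` (W \<inter> \<Omega>))"
    if "W' \<subseteq> W" "W \<subseteq> W0" "x \<in> X" "e x ws ws' \<noteq> 0" "ws \<in> W" "ws \<in> \<Omega>" "ws' \<in> W" "ws' \<in> \<Omega>"
      "\<And>w. w \<in> W' \<Longrightarrow> w \<in> \<Omega> \<Longrightarrow> B x w = 0" for W W' x ws ws'
  proof (rule dim_add_2_le[OF _ _ _ tgt.linear_left tgt.linear_left])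
    show "B' (f ws) (f x) * B' (f ws') (h x) - B' (f ws') (f x) * B' (f ws) (h x) \<noteq> 0"
      using that by (simp add: e_def)
    show "B' v (f x) = 0" "B' v (h x) = 0" if "v \<in> f ` (W' \<inter> \<Omega>)" for v
      using orth[of x] that \<open>W' \<subseteq> W\<close> \<open>W \<subseteq> W0\<close> \<open>x \<in> X\<close> \<open>\<And>w. w \<in> W' \<Longrightarrow> w \<in> \<Omega> \<Longrightarrow> B x w = 0\<close> by blast+
  qed (use that in auto)
  {
    case 0
    note W = 0(1-3) and inc = 0(4-7) and bad = 0(8-13)
    obtain x1 w1 where x1: "x1 \<in> X" "w1 \<in> W \<inter> \<Omega>" "B x1 w1 = 0" "e x1 ws ws' \<noteq> 0"
      using start[OF W(1) _ inc bad(1,6)] W(3) by auto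
    then have "w1 \<noteq> 0" using \<Omega> by auto
    then obtain y where y: "B y w1 = 1" using src.dual_vector by blast
    obtain y' where y': "B' (f ws) y' \<noteq> 0" using bad(6) unfolding e_def by fastforce
    define w where "w t = w1 + t *s (ws - w1)" for t
    define x where "x t = x1 - (B x1 (w t) / B y (w t)) *s y" for t
    have wt: "(w \<longlongrightarrow> w1) (at 0)" unfolding w_def[abs_def] by (rule line_tendsto)
    have "((\<lambda>t. B y (w t)) \<longlongrightarrow> B y w1) (at 0)" by (intro src.bil.tendsto wt tendsto_intros)
    then have "\<forall>\<^sub>F t in at 0. B y (w t) \<noteq> 0" using y by (intro tendsto_imp_eventually_ne) auto
    moreover have "(x \<longlongrightarrow> x1 - (B x1 w1 / B y w1) *s y) (at 0)"
      unfolding x_def[abs_def] using y by (intro tendsto_intros src.bil.tendsto wt) auto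
    then have "\<forall>\<^sub>F t in at 0. x t \<in> X \<and> e (x t) ws ws' \<noteq> 0"
      using x1 by (intro e_tendsto[of x1]) auto
    moreover have "\<forall>\<^sub>F t in at 0. w t \<in> \<Omega>" using x1 \<Omega> by (intro topological_tendstoD[OF wt]) auto
    moreover have "\<forall>\<^sub>F t in at 0. B' (f (w t)) y' \<noteq> 0"
      unfolding w_def
      by (rule eventually_nonzero_near_0[OF f_hol open_line[OF \<Omega>(1)] convex_connected[OF convex_line[OF \<Omega>(2)]]])
        (use x1 bad y' in auto)
    ultimately have "\<forall>\<^sub>F t in at 0. B y (w t) \<noteq> 0 \<and> x t \<in> X \<and> e (x t) ws ws' \<noteq> 0 \<and> w t \<in> \<Omega> \<and> B' (f (w t)) y' \<noteq> 0"
      by eventually_elim simp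
    then obtain t where t: "B y (w t) \<noteq> 0" "x t \<in> X" "e (x t) ws ws' \<noteq> 0" "w t \<in> \<Omega>" "B' (f (w t)) y' \<noteq> 0"
      using eventually_happens by fastforce
    have wW: "w t \<in> W" using x1 bad W by (simp add: w_def vec.subspace_add vec.subspace_diff vec.subspace_scale)
    \<comment> \<open>At the bottom of the induction one point replaces the hyperplane section. Its
      image is nonzero, as \<open>y'\<close> detects, and contributes 1; the independent functionals
      add 2.\<close>
    have "vec.dim (f ` ({w t} \<inter> \<Omega>)) + 2 \<le> vec.dim (f ` (W \<inter> \<Omega>))"
    proof (rule lin2[of "{w t}" W "x t" ws ws'])
      show "B (x t) u = 0" if "u \<in> {w t}" for u
        using t that by (simp add: x_def src.expand)
    qed (use t wW bad W in simp_all)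
    moreover have "f (w t) \<noteq> 0" using t by (auto simp: tgt.bil.zero_left)
    then have "vec.dim (f ` ({w t} \<inter> \<Omega>)) = 1" using t by (simp add: vec.dim_insert)
    ultimately show ?case by simp
  next
    case (Suc k)
    note W = Suc.prems(1-3) and inc = Suc.prems(4-7) and bad = Suc.prems(8-13)
    obtain x1 w1 where x1: "x1 \<in> X" "w1 \<in> W \<inter> \<Omega>" "B x1 w1 = 0" "e x1 ws ws' \<noteq> 0"
      using start[OF W(1) _ inc bad(1,6)] W(3) by auto
    then have "w1 \<noteq> 0" using \<Omega> by auto
    have sub: "vec.subspace (W \<inter> {w. B w x = 0})" for x
      using W(1) by (auto simp: vec.subspace_def src.expand src.bil.zero_left)
    have dim: "k + 2 \<le> vec.dim (W \<inter> {w. B w x = 0})" for x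
      using dim_le_Suc_dim_kernel[OF W(1) src.linear_left[of x]] W(3) by simp
    have "w1 \<in> (W \<inter> {w. B w x1 = 0}) \<inter> \<Omega>" using x1 src.zero_iff_sym by auto
    then obtain w1' where w1': "w1' \<in> (W \<inter> {w. B w x1 = 0}) \<inter> \<Omega>"
      "w1' \<notin> vec.span {w1}" "w1 \<notin> vec.span {w1'}"
      using orthogonal_pair_in[OF sub _ \<Omega>(1)] dim[of x1] \<open>w1 \<noteq> 0\<close> by (metis add_leD2)
    have x1w: "B x1 w1' = 0" using w1' src.zero_iff_sym by auto
    \<comment> \<open>\<open>y\<close> and \<open>y'\<close> are dual to \<open>w1\<close> and
      \<open>w1'\<close>, which makes the Cramer determinant \<open>\<Delta>\<close> tend to 1; for
      this the two points were chosen independent.\<close>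
    obtain y where y: "B y w1 = 1" "B y w1' = 0" using src.dual_vector_pair[OF w1'(3)] by blast
    obtain y' where y': "B y' w1 = 0" "B y' w1' = 1" using src.dual_vector_pair[OF w1'(2)] by blast
    define v where "v t = w1 + t *s (ws - w1)" for t
    define v' where "v' t = w1' + t *s (ws' - w1')" for t
    \<comment> \<open>x t is the point near x1, given by Cramer's rule, that is orthogonal to both v t and v' t\<close>
    define \<Delta> where "\<Delta> t = B y (v t) * B y' (v' t) - B y' (v t) * B y (v' t)" for t
    define x where "x t = x1 - ((B x1 (v t) * B y' (v' t) - B x1 (v' t) * B y' (v t)) / \<Delta> t) *s y
        - ((B y (v t) * B x1 (v' t) - B y (v' t) * B x1 (v t)) / \<Delta> t) *s y'" for t
    have vt: "(v \<longlongrightarrow> w1) (at 0)" unfolding v_def[abs_def] by (rule line_tendsto)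
    have v't: "(v' \<longlongrightarrow> w1') (at 0)" unfolding v'_def[abs_def] by (rule line_tendsto)
    have "(\<Delta> \<longlongrightarrow> B y w1 * B y' w1' - B y' w1 * B y w1') (at 0)"
      unfolding \<Delta>_def[abs_def] by (intro tendsto_intros src.bil.tendsto vt v't)
    then have \<Delta>t: "(\<Delta> \<longlongrightarrow> 1) (at 0)" by (simp add: y y')
    then have "\<forall>\<^sub>F t in at 0. \<Delta> t \<noteq> 0" by (rule tendsto_imp_eventually_ne) simp
    moreover have "(x \<longlongrightarrow> x1 - ((B x1 w1 * B y' w1' - B x1 w1' * B y' w1) / 1) *s y
        - ((B y w1 * B x1 w1' - B y w1' * B x1 w1) / 1) *s y') (at 0)"
      unfolding x_def[abs_def] by (intro tendsto_intros src.bil.tendsto vt v't \<Delta>t) simp_all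
    then have "\<forall>\<^sub>F t in at 0. x t \<in> X \<and> e (x t) ws ws' \<noteq> 0"
      using x1 x1w by (intro e_tendsto[of x1]) auto
    moreover have "\<forall>\<^sub>F t in at 0. v t \<in> \<Omega>" using x1 \<Omega> by (intro topological_tendstoD[OF vt]) auto
    moreover have "\<forall>\<^sub>F t in at 0. v' t \<in> \<Omega>" using w1' \<Omega> by (intro topological_tendstoD[OF v't]) auto
    \<comment> \<open>At the unchanged point \<open>xs\<close>, the witnesses \<open>ws\<close>,
      \<open>ws'\<close> are replaced by \<open>v t\<close>, \<open>v' t\<close>, which lie in the
      hyperplane orthogonal to \<open>x t\<close>. So independence survives the restriction to
      \<open>W'\<close>.\<close>
    moreover have "\<forall>\<^sub>F t in at 0. e xs (v t) (v' t) \<noteq> 0"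
    proof (rule eventually_nonzero_near_0)
      define S where "S = {t. w1 + t *s (ws - w1) \<in> \<Omega>} \<inter> {t. w1' + t *s (ws' - w1') \<in> \<Omega>}"
      show "(\<lambda>t. e xs (v t) (v' t)) holomorphic_on S"
        unfolding e_def v_def v'_def
        by (intro holomorphic_intros holomorphic_on_subset[OF f_hol]) (auto simp: S_def)
      show "open S" unfolding S_def by (intro open_Int open_line \<Omega>)
      show "connected S" unfolding S_def by (intro convex_connected convex_Int convex_line \<Omega>)
      show "0 \<in> S" "1 \<in> S" "e xs (v 1) (v' 1) \<noteq> 0"
        using x1 w1' bad by (auto simp: S_def v_def v'_def)
    qed
    ultimately have "\<forall>\<^sub>F t in at 0. \<Delta> t \<noteq> 0 \<and> x t \<in> X \<and> e (x t) ws ws' \<noteq> 0 \<and> v t \<in> \<Omega> \<and> v' t \<in> \<Omega> \<and> e xs (v t) (v' t) \<noteq> 0"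
      by eventually_elim simp
    then obtain t where t: "\<Delta> t \<noteq> 0" "x t \<in> X" "e (x t) ws ws' \<noteq> 0" "v t \<in> \<Omega>" "v' t \<in> \<Omega>" "e xs (v t) (v' t) \<noteq> 0"
      using eventually_happens by fastforce
    have vW: "v t \<in> W" "v' t \<in> W"
      using x1 w1' bad W by (simp_all add: v_def v'_def vec.subspace_add vec.subspace_diff vec.subspace_scale)
    have xv: "B (x t) (v t) = 0" "B (x t) (v' t) = 0"
    proof -
      have "\<Delta> t * B (x t) (v t) = 0" "\<Delta> t * B (x t) (v' t) = 0"
        using t(1) by (simp_all add: x_def src.expand field_simps) (simp_all add: \<Delta>_def algebra_simps)
      then show "B (x t) (v t) = 0" "B (x t) (v' t) = 0" using t by simp_all
    qed
    define W' where "W' = W \<inter> {w. B w (x t) = 0}"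
    have vW': "v t \<in> W'" "v' t \<in> W'" using vW xv src.zero_iff_sym by (auto simp: W'_def)
    have "2 * k + 3 \<le> vec.dim (f ` (W' \<inter> \<Omega>))"
      by (rule Suc.IH[of W' "v t" "x t" xs "v t" "v' t"])
        (use sub dim t bad vW' xv W in \<open>auto simp: W'_def\<close>)
    moreover have "vec.dim (f ` (W' \<inter> \<Omega>)) + 2 \<le> vec.dim (f ` (W \<inter> \<Omega>))"
    proof (rule lin2[of W' W "x t" ws ws'])
      show "B (x t) u = 0" if "u \<in> W'" for u
        using that src.zero_iff_sym by (simp add: W'_def)
    qed (use t bad W in \<open>simp_all add: W'_def\<close>)
    ultimately show ?case by simp
  }
qed

end

section \<open>Germs of orthogonal maps\<close>

text \<open>\<open>f\<close> is a local lift after projection to the nondegenerate part of the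
  target; it could vanish a priori, and \<open>generic\<close> excludes this. The factor in
  \<open>homog\<close> is the ambiguity of representatives. \<open>small_dim\<close> is the
  hypothesis on s': the image spans at most s' + 1 dimensions, and the source has s + 1. The
  signature of the target is left out here and enters with \<open>lorentz\<close> in
  \<open>local_isometry\<close>.\<close>

locale orth_germ = two_forms B B'
  for B :: "complex^'n \<Rightarrow> complex^'n \<Rightarrow> complex" and B' :: "complex^'m \<Rightarrow> complex^'m \<Rightarrow> complex" +
  fixes f :: "complex^'n \<Rightarrow> complex^'m" and D :: "complex^'n \<Rightarrow> complex^'n \<Rightarrow> complex^'m"
    and \<Omega> :: "(complex^'n) set" and p :: "complex^'n"
  assumes open_dom: "open \<Omega>" and convex_dom: "convex \<Omega>" and zero_notin_dom: "0 \<notin> \<Omega>"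
    and has_deriv: "x \<in> \<Omega> \<Longrightarrow> (f has_derivative D x) (at x)"
    and deriv_scale: "x \<in> \<Omega> \<Longrightarrow> D x (c *s v) = c *s D x v"
    and orth: "x \<in> \<Omega> \<Longrightarrow> w \<in> \<Omega> \<Longrightarrow> B x w = 0 \<Longrightarrow> B' (f x) (f w) = 0"
    and homog: "x \<in> \<Omega> \<Longrightarrow> c *s x \<in> \<Omega> \<Longrightarrow> \<exists>\<mu>. \<mu> \<noteq> 0 \<and> f (c *s x) = \<mu> *s f x"
    and small_dim: "vec.dim (f ` \<Omega>) + 3 \<le> 2 * CARD('n)"
    and generic: "q \<in> \<Omega> \<Longrightarrow> \<exists>w\<in>\<Omega>. B' (f q) (f w) \<noteq> 0"
    and null_point: "p \<in> \<Omega>" "B p p = 0"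
begin

lemma f_hol: "(\<lambda>t. B' (f (z + t *s u)) y) holomorphic_on {t. z + t *s u \<in> \<Omega>}"
  by (rule holomorphic_on_line[OF open_dom, where DG = "\<lambda>x v. B' (D x v) y"])
    (simp_all add: tgt.has_derivative_left has_deriv deriv_scale tgt.scale_left)

lemma D_hol: "(\<lambda>t. B' (D (z + t *s u) v) y) holomorphic_on {t. z + t *s u \<in> \<Omega>}"
  by (rule derivative_holomorphic_on_line[OF open_dom, where DG = "\<lambda>x v. B' (D x v) y"
        and G = "\<lambda>x. B' (f x) y"])
    (simp_all add: tgt.has_derivative_left has_deriv deriv_scale tgt.scale_left)

lemma f_cont: "continuous_on \<Omega> f"
  using has_deriv by (meson continuous_at_imp_continuous_on has_derivative_continuous)

lemma D_cont: "continuous_on \<Omega> (\<lambda>x. D x v)"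
proof -
  have "continuous_on \<Omega> (\<lambda>x. D x v $ i)" for i
  proof (rule derivative_continuous[OF open_dom, where DG = "\<lambda>x v. D x v $ i" and G = "\<lambda>x. f x $ i"])
    show "((\<lambda>x. f x $ i) has_derivative (\<lambda>v. D x v $ i)) (at x)" if "x \<in> \<Omega>" for x
      using bounded_linear.has_derivative[OF bounded_linear_vec_nth has_deriv[OF that]] .
  qed (simp add: deriv_scale)
  then have "continuous_on \<Omega> (\<lambda>x. \<chi> i. D x v $ i)" by (intro continuous_on_vec_lambda)
  then show ?thesis by simp
qed

section \<open>Consequences of the dimension bound\<close>

lemma card_ge_3: "3 \<le> CARD('n)"
proof -
  obtain w where w: "w \<in> \<Omega>" "B' (f p) (f w) \<noteq> 0" using generic null_point by blast
  \<comment> \<open>\<open>f p\<close> is null but not orthogonal to \<open>f w\<close>, so the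
    image spans at least a plane and \<open>small_dim\<close> becomes 5 \<le> 2 n.\<close>
  have "vec.dim {f p} + 1 \<le> vec.dim (f ` \<Omega>)"
  proof (rule dim_add_1_le[OF _ _ tgt.linear_left])
    show "B' v (f p) = 0" if "v \<in> {f p}" for v
      using that orth null_point by simp
    show "B' (f w) (f p) \<noteq> 0" using w tgt.zero_iff_sym by blast
  qed (use w null_point in auto)
  moreover have "f p \<noteq> 0" using w by (auto simp: tgt.bil.zero_left)
  then have "vec.dim {f p} = 1" by (simp add: vec.dim_insert)
  ultimately show ?thesis using small_dim by simp
qed

text \<open>For vectors orthogonal to \<open>q\<close>, orthogonality to \<open>x\<close> and to
  \<open>x + \<tau> *s q\<close> is the same condition, so the translate of \<open>f\<close> is a
  legitimate second field over the complement of \<open>q\<close>. The points \<open>x1\<close> and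
  \<open>w1\<close> provide the orthogonal pair from which the count starts.\<close>

lemma cross_ratio:
  assumes q: "q \<in> \<Omega>" and x: "x \<in> \<Omega>" "x + \<tau> *s q \<in> \<Omega>"
    and w: "w \<in> \<Omega>" "w' \<in> \<Omega>" "B q w = 0" "B q w' = 0"
    and inc: "x1 \<in> \<Omega>" "x1 + \<tau> *s q \<in> \<Omega>" "w1 \<in> \<Omega>" "B q w1 = 0" "B x1 w1 = 0"
  shows "B' (f x) (f w) * B' (f (x + \<tau> *s q)) (f w') = B' (f x) (f w') * B' (f (x + \<tau> *s q)) (f w)"
proof (rule ccontr)
  assume neq: "\<not> ?thesis"
  define W where "W = {w. B w q = 0}"
  define X where "X = \<Omega> \<inter> (\<lambda>x. x + \<tau> *s q) -` \<Omega>"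
  have sub: "vec.subspace W" by (auto simp: W_def vec.subspace_def src.expand src.bil.zero_left)
  have "CARD('n) \<le> vec.dim W + 1"
    using dim_le_Suc_dim_kernel[OF vec.subspace_UNIV src.linear_left[of q]] unfolding W_def vec_dim_card by simp
  then have dimW: "(CARD('n) - 3) + 2 \<le> vec.dim W" using card_ge_3 by simp
  have translate: "(\<lambda>x. x + \<tau> *s q) -` \<Omega> = (\<lambda>x. - (\<tau> *s q) + x) ` \<Omega>"
    by (auto simp: image_iff) (metis add.commute add_diff_cancel diff_add_cancel uminus_add_conv_diff)
  have "2 * (CARD('n) - 3) + 3 \<le> vec.dim (f ` (W \<inter> \<Omega>))"
  proof (rule flag_dimension[where h = "\<lambda>x. f (x + \<tau> *s q)" and X = X and W0 = W and ?w0.0 = w1 and ?x0.0 = x1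
        and xs = x and ws = w and ws' = w'])
    show "open X" "convex X" "X \<subseteq> \<Omega>"
      using open_dom convex_dom unfolding X_def translate
      by (auto intro!: open_Int open_translation_subtract convex_Int convex_translation_subtract)
    show "(\<lambda>t. B' (f (z + t *s u)) y) holomorphic_on {t. z + t *s u \<in> \<Omega>}" for z u y by (rule f_hol)
    show "(\<lambda>t. B' (f (z + t *s u + \<tau> *s q)) y) holomorphic_on {t. z + t *s u \<in> X}" for z u y
      using holomorphic_on_subset[OF f_hol[of "z + \<tau> *s q" u y], of "{t. z + t *s u \<in> X}"]
      by (auto simp: X_def add_ac)
    show "continuous_on X (\<lambda>x. f (x + \<tau> *s q))"
      by (rule continuous_on_compose2[OF f_cont]) (auto simp: X_def intro!: continuous_intros)
    show "B' (f w) (f x) = 0 \<and> B' (f w) (f (x + \<tau> *s q)) = 0"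
      if "x \<in> X" "w \<in> \<Omega>" "w \<in> W" "B x w = 0" for x w
    proof
      have "B q w = 0" using that src.zero_iff_sym by (simp add: W_def)
      then have "B (x + \<tau> *s q) w = 0" using that by (simp add: src.expand)
      then show "B' (f w) (f (x + \<tau> *s q)) = 0"
        using orth[of "x + \<tau> *s q" w] that tgt.zero_iff_sym by (auto simp: X_def)
      show "B' (f w) (f x) = 0" using orth[of x w] that tgt.zero_iff_sym by (auto simp: X_def)
    qed
    have "cnj (B' (f w) (f x) * B' (f w') (f (x + \<tau> *s q)) - B' (f w') (f x) * B' (f w) (f (x + \<tau> *s q))) \<noteq> 0"
      using neq by (simp add: tgt.herm_sym[symmetric])
    then show "B' (f w) (f x) * B' (f w') (f (x + \<tau> *s q)) - B' (f w') (f x) * B' (f w) (f (x + \<tau> *s q)) \<noteq> 0"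
      by (metis complex_cnj_zero_iff)
  qed (use open_dom convex_dom zero_notin_dom f_cont sub dimW x w inc src.zero_iff_sym in \<open>auto simp: X_def W_def\<close>)
  moreover obtain y where y: "y \<in> \<Omega>" "B' (f q) (f y) \<noteq> 0" using generic q by blast
  have "vec.dim (f ` (W \<inter> \<Omega>)) + 1 \<le> vec.dim (f ` \<Omega>)"
  proof (rule dim_add_1_le[OF _ _ tgt.linear_left])
    show "B' v (f q) = 0" if "v \<in> f ` (W \<inter> \<Omega>)" for v
      using that orth q by (auto simp: W_def)
    show "B' (f y) (f q) \<noteq> 0" using y tgt.zero_iff_sym by blast
  qed (use y in auto)
  ultimately show False using small_dim card_ge_3 by linarith
qed

text \<open>If all these derivatives vanished, \<open>D x v\<close> would be a second field over the
  whole space, and the count would force the two functionals to be dependent everywhere. By the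
  Wronskian, all functionals <., f x> would then be proportional on the image of
  \<open>f\<close>.\<close>

lemma nonzero_derivative:
  "\<exists>x w v. x \<in> \<Omega> \<and> w \<in> \<Omega> \<and> B x w = 0 \<and> B' (D x v) (f w) \<noteq> 0"
proof (rule ccontr)
  assume "\<not> ?thesis"
  then have D0: "B' (D x v) (f w) = 0" if "x \<in> \<Omega>" "w \<in> \<Omega>" "B x w = 0" for x w v
    using that by blast
  have e0: "B' (f w) (f x) * B' (f w') (D x v) - B' (f w') (f x) * B' (f w) (D x v) = 0"
    if x: "x \<in> \<Omega>" and w: "w \<in> \<Omega>" "w' \<in> \<Omega>" for x w w' v
  proof (rule ccontr)
    assume neq: "\<not> ?thesis"
    have "2 * (CARD('n) - 2) + 3 \<le> vec.dim (f ` (UNIV \<inter> \<Omega>))"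
    proof (rule flag_dimension[where h = "\<lambda>x. D x v" and X = \<Omega> and W0 = UNIV and ?w0.0 = p and ?x0.0 = p
          and xs = x and ws = w and ws' = w'])
      show "B' (f w) (f x) = 0 \<and> B' (f w) (D x v) = 0"
        if "x \<in> \<Omega>" "w \<in> \<Omega>" "B x w = 0" for x w
        using orth[OF that] D0[OF that] tgt.zero_iff_sym by auto
      show "CARD('n) - 2 + 2 \<le> vec.dim (UNIV :: (complex^'n) set)"
        unfolding vec_dim_card using card_ge_3 by simp
    qed (use open_dom convex_dom zero_notin_dom f_cont D_cont f_hol D_hol null_point x w neq in auto)
    then show False using small_dim card_ge_3 by simp
  qed
  have proportional: "B' (f x) (f w) * B' (f x') (f w') = B' (f x') (f w) * B' (f x) (f w')"
    if x: "x \<in> \<Omega>" "x' \<in> \<Omega>" and w: "w \<in> \<Omega>" "w' \<in> \<Omega>" for x x' w w'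
  proof -
    define d where "d = x' - x"
    have d: "x' = x + 1 *s d" by (simp add: d_def)
    have der: "((\<lambda>t. B' (f (x + t *s d)) y) has_field_derivative B' (D (x + t *s d) d) y) (at t)"
      if "x + t *s d \<in> \<Omega>" for t y
      by (rule has_field_derivative_line) (simp_all add: tgt.has_derivative_left has_deriv deriv_scale tgt.scale_left that)
    have "B' (f (x + 0 *s d)) (f w) * B' (f (x + 1 *s d)) (f w') = B' (f (x + 1 *s d)) (f w) * B' (f (x + 0 *s d)) (f w')"
    proof (rule wronskian_zero[OF open_line[OF open_dom, of x d] convex_connected[OF convex_line[OF convex_dom, of x d]]])
      fix t assume t: "t \<in> {t. x + t *s d \<in> \<Omega>}"
      have "cnj (B' (f w) (f (x + t *s d)) * B' (f w') (D (x + t *s d) d)) =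
            cnj (B' (f w') (f (x + t *s d)) * B' (f w) (D (x + t *s d) d))"
        using e0[of "x + t *s d" w w' d] t w by simp
      then show "B' (f (x + t *s d)) (f w) * B' (D (x + t *s d) d) (f w') = B' (f (x + t *s d)) (f w') * B' (D (x + t *s d) d) (f w)"
        by (simp add: tgt.herm_sym[symmetric])
    qed (use der x d in auto)
    then show ?thesis using d by simp
  qed
  obtain w where w: "w \<in> \<Omega>" "B' (f p) (f w) \<noteq> 0" using generic null_point by blast
  then have "B' (f w) (f p) \<noteq> 0" using tgt.zero_iff_sym by blast
  moreover have "B' (f p) (f p) = 0" using orth null_point by blast
  \<comment> \<open>With \<open>f p\<close> null, proportionality reads 0 = |<f p, f w>|^2.\<close>
  ultimately show False using proportional[of p w p w] w null_point by simp
qed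

section \<open>First-order behaviour along orthogonal pairs\<close>

lemma tangent_sum_zero:
  assumes x: "x \<in> \<Omega>" "w \<in> \<Omega>" "B x w = 0" and v: "B v w + B x u = 0" "B v u = 0"
  shows "B' (D x v) (f w) + B' (f x) (D w u) = 0"
proof -
  define g where "g t = B' (f (x + t *\<^sub>R v)) (f (w + t *\<^sub>R u))" for t :: real
  have line: "((\<lambda>t::real. f (z + t *\<^sub>R y)) has_derivative (\<lambda>h. D z (h *\<^sub>R y))) (at 0)" if "z \<in> \<Omega>" for z y
  proof -
    have "((\<lambda>t::real. z + t *\<^sub>R y) has_derivative (\<lambda>h. h *\<^sub>R y)) (at 0)"
      by (auto intro!: derivative_eq_intros)
    from diff_chain_at[OF this] has_deriv[OF that] show ?thesis by (simp add: o_def)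
  qed
  have "(g has_derivative (\<lambda>h. B' (f (x + 0 *\<^sub>R v)) (D w (h *\<^sub>R u)) + B' (D x (h *\<^sub>R v)) (f (w + 0 *\<^sub>R u)))) (at 0)"
    unfolding g_def[abs_def] by (rule tgt.bil.FDERIV[OF line[OF x(1)] line[OF x(2)]])
  moreover have "\<forall>\<^sub>F t in nhds 0. g t = 0"
  proof -
    have t: "((\<lambda>t::real. z + t *\<^sub>R y) \<longlongrightarrow> z + 0 *\<^sub>R y) (nhds 0)" for z y :: "complex^'n"
      by (intro tendsto_intros) (simp add: filterlim_ident)
    have "\<forall>\<^sub>F t::real in nhds 0. x + t *\<^sub>R v \<in> \<Omega>" "\<forall>\<^sub>F t::real in nhds 0. w + t *\<^sub>R u \<in> \<Omega>"
      using x by (intro topological_tendstoD[OF t] open_dom; simp)+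
    then show ?thesis
    proof eventually_elim
      case (elim t)
      \<comment> \<open>The assumption \<open>B v u = 0\<close> removes the quadratic term, so a
        straight motion of both points stays inside the orthogonality relation. The parameter is
        real because the second slot is conjugate linear.\<close>
      have "B (x + t *\<^sub>R v) (w + t *\<^sub>R u) = B x w + complex_of_real t * (B v w + B x u) + complex_of_real (t^2) * B v u"
        by (simp add: src.expand scaleR_eq_smult algebra_simps power2_eq_square)
      then show ?case unfolding g_def using x v elim by (intro orth) auto
    qed
  qed
  then have "(g has_derivative (\<lambda>h. 0)) (at 0)"
    by (intro has_derivative_transform_eventually[OF has_derivative_const[of 0]])
      (auto simp: eventually_at_filter elim!: eventually_mono dest: eventually_nhds_x_imp_x)
  ultimately have "(\<lambda>h. B' (f (x + 0 *\<^sub>R v)) (D w (h *\<^sub>R u)) + B' (D x (h *\<^sub>R v)) (f (w + 0 *\<^sub>R u))) = (\<lambda>h. 0)"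
    by (rule has_derivative_unique)
  from fun_cong[OF this, of 1] show ?thesis by (simp add: add.commute)
qed

lemma deriv_zero: "x \<in> \<Omega> \<Longrightarrow> D x 0 = 0"
  using deriv_scale[of x 0 0] by simp

lemma deriv_add: "x \<in> \<Omega> \<Longrightarrow> D x (u + v) = D x u + D x v"
  using has_deriv has_derivative_linear linear_add by blast

text \<open>b vanishes wherever \<open>B\<close> does, so at an orthogonal pair its differential is
  a multiple of that of \<open>B\<close>. One constant \<open>\<kappa>\<close> serves both slots,
  which lets a nonzero derivative in one slot be used in the other.\<close>

lemma incidence_derivative:
  assumes x: "x \<in> \<Omega>" "w \<in> \<Omega>" "B x w = 0"
  obtains \<kappa> where "\<And>v. B' (D x v) (f w) = \<kappa> * B v w" "\<And>v. B' (f x) (D w v) = \<kappa> * B x v"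
proof -
  have nz: "x \<noteq> 0" "w \<noteq> 0" using x zero_notin_dom by auto
  obtain v1 where v1: "B v1 w = 1" using src.dual_vector[OF nz(2)] by blast
  define \<kappa> where "\<kappa> = B' (D x v1) (f w)"
  have 1: "B' (D x v) (f w) = \<kappa> * B v w" for v
  proof -
    have "B' (D x (v + (- B v w) *s v1)) (f w) + B' (f x) (D w 0) = 0"
      by (rule tangent_sum_zero[OF x]) (simp_all add: src.expand v1 src.bil.zero_right src.bil.minus_left)
    then have "B' (D x (v + (- B v w) *s v1)) (f w) = 0"
      by (simp only: deriv_zero x tgt.bil.zero_right add_0_right)
    then show ?thesis
      by (simp only: deriv_add deriv_scale x tgt.expand) (simp add: \<kappa>_def)
  qed
  have "x \<notin> vec.span {v1}"
  proof
    assume "x \<in> vec.span {v1}"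
    then obtain c where "x = c *s v1" by (auto simp: vec.span_singleton)
    then show False using x v1 nz by (auto simp: src.expand)
  qed
  \<comment> \<open>Since \<open>u1\<close> is orthogonal to \<open>v1\<close>, moving along
    \<open>v1\<close> and \<open>- u1\<close> at once is an admissible motion; it equates the
    constants of the two slots.\<close>
  then obtain u1 where u1: "B u1 v1 = 0" "B u1 x = 1" using src.dual_vector_pair by blast
  have 2: "B' (f x) (D w u) = 0" if "B x u = 0" for u
    using tangent_sum_zero[OF x, of 0 u] that by (simp add: src.bil.zero_left deriv_zero x tgt.bil.zero_left)
  have u1': "B x u1 = 1" "B v1 u1 = 0" using u1 src.herm_sym[of x u1] src.zero_iff_sym by auto
  have "B' (D x v1) (f w) + B' (f x) (D w ((-1) *s u1)) = 0"
    by (rule tangent_sum_zero[OF x]) (simp_all only: src.expand v1 u1', simp_all)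
  then have 3: "B' (f x) (D w u1) = \<kappa>" by (simp only: deriv_scale x tgt.expand) (simp add: \<kappa>_def)
  have "B' (f x) (D w u) = \<kappa> * B x u" for u
  proof -
    have "B x (u + (- B u x) *s u1) = 0"
      by (simp only: src.expand u1') (simp add: src.herm_sym[symmetric])
    then have "B' (f x) (D w (u + (- B u x) *s u1)) = 0" by (rule 2)
    then have "B' (f x) (D w u) - B x u * \<kappa> = 0"
      by (simp only: deriv_add deriv_scale x tgt.expand 3) (simp add: src.herm_sym[symmetric])
    then show ?thesis by simp
  qed
  then show ?thesis using 1 that by blast
qed

section \<open>Factorization of the pulled-back form\<close>

lemma nhds_ident_tendsto: "((\<lambda>x. x) \<longlongrightarrow> a) (nhds a)"
  by (rule filterlim_ident)

lemma happens_at_0: "\<forall>\<^sub>F t in at (0::complex). P t \<Longrightarrow> \<exists>t. P t"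
  using eventually_happens by fastforce

lemmas identity_on_lines = identity_on_convex[OF open_dom convex_dom]

text \<open>With \<open>x0\<close> fixed, both sides are holomorphic in \<open>w\<close>, so an
  identity for \<open>w\<close> in a small open set extends to the whole domain. The factor
  \<open>k\<close> is the ratio of the conjugated incidence constants of \<open>x\<close> and
  \<open>x0\<close> at a common orthogonal point \<open>w' x\<close>, hence depends on
  \<open>x\<close> alone.\<close>

lemma product_form:
  obtains x0 S where "x0 \<in> \<Omega>" "open S" "S \<noteq> {}" "S \<subseteq> \<Omega>"
    "\<And>x. x \<in> S \<Longrightarrow> \<exists>k. \<forall>w\<in>\<Omega>. B' (f w) (f x) * B w x0 = k * B' (f w) (f x0) * B w x"
proof -
  obtain x0 w0 v0 where x0: "x0 \<in> \<Omega>" "w0 \<in> \<Omega>" "B x0 w0 = 0" "B' (D x0 v0) (f w0) \<noteq> 0"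
    using nonzero_derivative by blast
  have nz: "x0 \<noteq> 0" using x0 zero_notin_dom by auto
  have "CARD('n) \<le> vec.dim {z. B z w0 = 0} + 1"
    using dim_le_Suc_dim_kernel[OF vec.subspace_UNIV src.linear_left[of w0]] unfolding vec_dim_card by simp
  then have "2 \<le> vec.dim {z. B z w0 = 0}" using card_ge_3 by simp
  moreover have "vec.subspace {z. B z w0 = 0}"
    by (auto simp: vec.subspace_def src.expand src.bil.zero_left)
  ultimately obtain q0 where q0: "q0 \<in> \<Omega>" "B q0 w0 = 0" "q0 \<notin> vec.span {x0}" "x0 \<notin> vec.span {q0}"
    using orthogonal_pair_in[of "{z. B z w0 = 0}" \<Omega> x0] open_dom x0 nz by auto
  obtain u where "B u q0 = 0" "B u x0 = 1" using src.dual_vector_pair[OF q0(4)] by blast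
  then have u: "B q0 u = 0" "B x0 u = 1" using src.zero_iff_sym src.herm_sym[of x0 u] by auto
  obtain g where "B g x0 = 0" "B g q0 = 1" using src.dual_vector_pair[OF q0(3)] by blast
  then have g: "B x0 g = 0" "B q0 g = 1" using src.zero_iff_sym src.herm_sym[of q0 g] by auto
  have ne0: "\<forall>\<^sub>F t in at (0::complex). t \<noteq> 0" by (simp add: eventually_at_filter)
  \<comment> \<open>Both \<open>(1 - \<tau>) *s x0\<close> and \<open>x2\<close> have to lie in the
    domain; they differ by \<open>\<tau> *s q0\<close>, as \<open>cross_ratio\<close>
    requires.\<close>
  have "\<forall>\<^sub>F t in at 0. x0 + t *s (- x0) \<in> \<Omega>" "\<forall>\<^sub>F t in at 0. x0 + t *s (q0 - x0) \<in> \<Omega>"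
    using open_dom x0 by (intro topological_tendstoD[OF line_tendsto]; simp)+
  with ne0 have "\<forall>\<^sub>F t in at 0. t \<noteq> 0 \<and> x0 + t *s (- x0) \<in> \<Omega> \<and> x0 + t *s (q0 - x0) \<in> \<Omega>"
    by eventually_elim blast
  from happens_at_0[OF this] obtain \<tau> where \<tau>: "\<tau> \<noteq> 0" "x0 + \<tau> *s (- x0) \<in> \<Omega>" "x0 + \<tau> *s (q0 - x0) \<in> \<Omega>"
    by blast
  define x2 where "x2 = x0 + \<tau> *s (q0 - x0)"
  have "\<forall>\<^sub>F t in at 0. w0 + t *s u \<in> \<Omega>"
    using open_dom x0 by (intro topological_tendstoD[OF line_tendsto]; simp)
  with ne0 have "\<forall>\<^sub>F t in at 0. t \<noteq> 0 \<and> w0 + t *s u \<in> \<Omega>" by eventually_elim blast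
  from happens_at_0[OF this] obtain \<epsilon> where \<epsilon>: "\<epsilon> \<noteq> 0" "w0 + \<epsilon> *s u \<in> \<Omega>" by blast
  define ws where "ws = w0 + \<epsilon> *s u"
  \<comment> \<open>\<open>w' x\<close> is the correction of \<open>w0\<close> orthogonal to both
    \<open>x0\<close> and \<open>x\<close>. The multiple \<open>c z *s x0\<close> has the same
    product with the second component of \<open>z\<close> as the first component has, so
    \<open>q z\<close> is orthogonal to that second component. At \<open>(x2, ws)\<close> these data
    become \<open>w0\<close>, \<open>1 - \<tau>\<close> and \<open>q0\<close>.\<close>
  define w' where "w' x = w0 - cnj (B x w0 / B x g) *s g" for x
  define c where "c z = B (fst z) (snd z) / B x0 (snd z)" for z
  define q where "q z = (1 / \<tau>) *s (fst z - c z *s x0)" for z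
  have x0ws: "B x0 ws = cnj \<epsilon>" "B x2 ws = (1 - \<tau>) * cnj \<epsilon>"
    using x0 q0 u by (simp_all add: ws_def x2_def src.expand algebra_simps)
  have x2: "B x2 w0 = 0" "B x2 g = \<tau>" using x0 q0 g by (simp_all add: x2_def src.expand)
  let ?F = "nhds (x2, ws)"
  have fst_t: "(fst \<longlongrightarrow> x2) ?F" and snd_t: "(snd \<longlongrightarrow> ws) ?F"
    using tendsto_fst[OF nhds_ident_tendsto] tendsto_snd[OF nhds_ident_tendsto] by fastforce+
  have Bg: "((\<lambda>z. B (fst z) g) \<longlongrightarrow> B x2 g) ?F" by (intro src.bil.tendsto fst_t tendsto_const)
  have Bx0: "((\<lambda>z. B x0 (snd z)) \<longlongrightarrow> B x0 ws) ?F" by (intro src.bil.tendsto snd_t tendsto_const)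
  have "((\<lambda>z. w' (fst z)) \<longlongrightarrow> w0 - cnj (B x2 w0 / B x2 g) *s g) ?F"
    unfolding w'_def using x2 \<tau> by (intro tendsto_intros src.bil.tendsto fst_t) auto
  then have w'_t: "((\<lambda>z. w' (fst z)) \<longlongrightarrow> w0) ?F" by (simp add: x2)
  have "(c \<longlongrightarrow> B x2 ws / B x0 ws) ?F"
    unfolding c_def[abs_def] using x0ws \<epsilon> by (intro tendsto_intros src.bil.tendsto fst_t snd_t) auto
  then have c_t: "(c \<longlongrightarrow> 1 - \<tau>) ?F" using x0ws \<epsilon> by simp
  then have cx0_t: "((\<lambda>z. c z *s x0) \<longlongrightarrow> (1 - \<tau>) *s x0) ?F" by (intro tendsto_intros)
  have "(q \<longlongrightarrow> (1 / \<tau>) *s (x2 - (1 - \<tau>) *s x0)) ?F"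
    unfolding q_def[abs_def] by (intro tendsto_intros fst_t c_t)
  moreover have "(1 / \<tau>) *s (x2 - (1 - \<tau>) *s x0) = q0"
    using \<tau> by (simp add: vec_eq_iff x2_def field_simps)
  ultimately have q_t: "(q \<longlongrightarrow> q0) ?F" by simp
  have "\<forall>\<^sub>F z in ?F. fst z \<in> \<Omega>" using \<tau> by (intro topological_tendstoD[OF fst_t] open_dom) (simp add: x2_def)
  moreover have "\<forall>\<^sub>F z in ?F. snd z \<in> \<Omega>" using \<epsilon> by (intro topological_tendstoD[OF snd_t] open_dom) (simp add: ws_def)
  moreover have w'_dom: "\<forall>\<^sub>F z in ?F. w' (fst z) \<in> \<Omega>" using x0 by (intro topological_tendstoD[OF w'_t] open_dom)
  moreover have "\<forall>\<^sub>F z in ?F. c z *s x0 \<in> \<Omega>"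
  proof (rule topological_tendstoD[OF cx0_t open_dom])
    have "(1 - \<tau>) *s x0 = x0 + \<tau> *s (- x0)" by (simp add: vec_eq_iff algebra_simps)
    then show "(1 - \<tau>) *s x0 \<in> \<Omega>" using \<tau> by simp
  qed
  moreover have "\<forall>\<^sub>F z in ?F. q z \<in> \<Omega>" using q0 by (intro topological_tendstoD[OF q_t] open_dom)
  moreover have "\<forall>\<^sub>F z in ?F. B (fst z) g \<noteq> 0" using x2 \<tau> by (intro tendsto_imp_eventually_ne[OF Bg]) auto
  moreover have "\<forall>\<^sub>F z in ?F. B x0 (snd z) \<noteq> 0" using x0ws \<epsilon> by (intro tendsto_imp_eventually_ne[OF Bx0]) auto
  moreover have "\<forall>\<^sub>F z in ?F. B' (D x0 v0) (f (w' (fst z))) \<noteq> 0"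
  proof (rule tendsto_imp_eventually_ne)
    show "((\<lambda>z. B' (D x0 v0) (f (w' (fst z)))) \<longlongrightarrow> B' (D x0 v0) (f w0)) ?F"
      by (rule tgt.bil.tendsto[OF tendsto_const continuous_on_tendsto_compose[OF f_cont w'_t x0(2) w'_dom]])
  qed (rule x0)
  ultimately have "\<forall>\<^sub>F z in ?F. fst z \<in> \<Omega> \<and> snd z \<in> \<Omega> \<and> w' (fst z) \<in> \<Omega> \<and> c z *s x0 \<in> \<Omega> \<and> q z \<in> \<Omega> \<and>
      B (fst z) g \<noteq> 0 \<and> B x0 (snd z) \<noteq> 0 \<and> B' (D x0 v0) (f (w' (fst z))) \<noteq> 0"
    by eventually_elim (intro conjI)
  then obtain R where R: "open R" "(x2, ws) \<in> R" and
    Rz: "\<And>z. z \<in> R \<Longrightarrow> fst z \<in> \<Omega> \<and> snd z \<in> \<Omega> \<and> w' (fst z) \<in> \<Omega> \<and> c z *s x0 \<in> \<Omega> \<and> q z \<in> \<Omega> \<and>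
      B (fst z) g \<noteq> 0 \<and> B x0 (snd z) \<noteq> 0 \<and> B' (D x0 v0) (f (w' (fst z))) \<noteq> 0"
    unfolding eventually_nhds by blast
  obtain S T where ST: "open S" "open T" "x2 \<in> S" "ws \<in> T" "S \<times> T \<subseteq> R"
    using open_prod_elim[OF R] by (metis SigmaE2)
  have inR: "fst (x, w) \<in> \<Omega> \<and> snd (x, w) \<in> \<Omega> \<and> w' x \<in> \<Omega> \<and> c (x, w) *s x0 \<in> \<Omega> \<and> q (x, w) \<in> \<Omega> \<and>
      B x g \<noteq> 0 \<and> B x0 w \<noteq> 0 \<and> B' (D x0 v0) (f (w' x)) \<noteq> 0" if "x \<in> S" "w \<in> T" for x w
    using Rz[of "(x, w)"] ST that by auto
  have key: "\<exists>k. \<forall>w\<in>\<Omega>. B' (f w) (f x) * B w x0 = k * B' (f w) (f x0) * B w x" if xS: "x \<in> S" for x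
  proof -
    note inx = inR[OF xS ST(4)]
    have w'_orth: "B x (w' x) = 0" "B x0 (w' x) = 0"
      using inx x0 g by (simp_all add: w'_def src.expand)
    obtain \<kappa>0 where \<kappa>0: "\<And>v. B' (D x0 v) (f (w' x)) = \<kappa>0 * B v (w' x)" "\<And>v. B' (f x0) (D (w' x) v) = \<kappa>0 * B x0 v"
      using incidence_derivative[of x0 "w' x"] x0 inx w'_orth by blast
    obtain \<kappa>1 where \<kappa>1: "\<And>v. B' (f x) (D (w' x) v) = \<kappa>1 * B x v"
      using incidence_derivative[OF _ _ w'_orth(1)] inx by (metis fst_conv)
    have \<kappa>0_nz: "\<kappa>0 \<noteq> 0" using inx \<kappa>0(1)[of v0] by auto
    define k where "k = cnj \<kappa>1 / cnj \<kappa>0"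
    have onT: "B' (f w) (f x) * B w x0 = k * B' (f w) (f x0) * B w x" if wT: "w \<in> T" for w
    proof -
      note inw = inR[OF xS wT]
      \<comment> \<open>y represents the point x0 and differs from x by a multiple of q (x, w), which is orthogonal to
        w and to w' x + t w; dividing the cross ratio identity by t and letting t tend to 0 gives the claim\<close>
      define y where "y = c (x, w) *s x0"
      have y: "y \<in> \<Omega>" "y + \<tau> *s q (x, w) = x" using inw \<tau> by (simp_all add: y_def q_def)
      obtain \<mu> where \<mu>: "\<mu> \<noteq> 0" "f y = \<mu> *s f x0" using homog x0 y unfolding y_def by blast
      have yw: "B y w = B x w" "B y (w' x) = 0" using inw w'_orth by (simp_all add: y_def c_def src.expand)
      have qw: "B (q (x, w)) w = 0" "B (q (x, w)) (w' x) = 0"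
        using yw w'_orth y_def by (simp_all add: q_def src.expand)
      define \<phi> where "\<phi> z t = B' (f (w' x + t *s w)) (f z)" for z t
      have d\<phi>: "(\<phi> z has_field_derivative B' (D (w' x) w) (f z)) (at 0)" for z
        unfolding \<phi>_def[abs_def] using has_field_derivative_line[of "\<lambda>v. B' (f v) (f z)" "\<lambda>v. B' (D (w' x) v) (f z)" "w' x" 0 w]
        inw by (simp add: tgt.has_derivative_left has_deriv deriv_scale tgt.scale_left)
      have "((\<lambda>t. w' x + t *s w) \<longlongrightarrow> w' x + 0 *s w) (nhds 0)" by (intro tendsto_intros nhds_ident_tendsto)
      then have "\<forall>\<^sub>F t in nhds 0. w' x + t *s w \<in> \<Omega>"
        using open_dom inw by (intro topological_tendstoD) auto
      then have ev: "\<forall>\<^sub>F t in nhds 0. B' (f w) (f x0) * \<phi> x t - \<phi> x0 t * B' (f w) (f x) = 0"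
      proof eventually_elim
        case (elim t)
        have "B (q (x, w)) (w' x + t *s w) = 0" using qw by (simp add: src.expand)
        then have "B' (f y) (f w) * B' (f x) (f (w' x + t *s w)) = B' (f y) (f (w' x + t *s w)) * B' (f x) (f w)"
          using cross_ratio[of "q (x, w)" y \<tau> w "w' x + t *s w" y "w' x"] inw elim y qw yw by simp
        then have "\<mu> * (B' (f x0) (f w) * B' (f x) (f (w' x + t *s w))) = \<mu> * (B' (f x0) (f (w' x + t *s w)) * B' (f x) (f w))"
          by (simp add: \<mu> tgt.scale_left)
        then have "cnj (B' (f x0) (f w) * B' (f x) (f (w' x + t *s w))) = cnj (B' (f x0) (f (w' x + t *s w)) * B' (f x) (f w))"
          using \<mu> by simp
        then show ?case by (simp add: \<phi>_def tgt.herm_sym[symmetric])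
      qed
      have "((\<lambda>t. B' (f w) (f x0) * \<phi> x t - \<phi> x0 t * B' (f w) (f x)) has_field_derivative
          B' (f w) (f x0) * B' (D (w' x) w) (f x) - B' (D (w' x) w) (f x0) * B' (f w) (f x)) (at 0)"
        by (rule DERIV_diff[OF DERIV_cmult[OF d\<phi>] DERIV_cmult_right[OF d\<phi>]])
      moreover have "((\<lambda>t. B' (f w) (f x0) * \<phi> x t - \<phi> x0 t * B' (f w) (f x)) has_field_derivative 0) (at 0)"
        using DERIV_cong_ev[OF refl ev refl] by simp
      ultimately have "B' (f w) (f x0) * B' (D (w' x) w) (f x) - B' (D (w' x) w) (f x0) * B' (f w) (f x) = 0"
        by (rule DERIV_unique)
      moreover have "B' (D (w' x) w) (f x) = cnj \<kappa>1 * B w x" "B' (D (w' x) w) (f x0) = cnj \<kappa>0 * B w x0"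
        using \<kappa>1[of w] \<kappa>0(2)[of w] tgt.herm_sym[of "D (w' x) w"] src.herm_sym[of w] by simp_all
      ultimately show ?thesis using \<kappa>0_nz by (simp add: k_def field_simps)
    qed
    have "B' (f w) (f x) * B w x0 - k * B' (f w) (f x0) * B w x = 0" if "w \<in> \<Omega>" for w
    proof (rule identity_on_lines[where S = T and a = ws and G = "\<lambda>w. B' (f w) (f x) * B w x0 - k * B' (f w) (f x0) * B w x"])
      show "(\<lambda>t. B' (f (z + t *s u)) (f x) * B (z + t *s u) x0 - k * B' (f (z + t *s u)) (f x0) * B (z + t *s u) x)
          holomorphic_on {t. z + t *s u \<in> \<Omega>}" for z u
        unfolding src.bil.add_left src.scale_left by (intro holomorphic_intros f_hol)
    qed (use ST that \<epsilon> onT in \<open>auto simp: ws_def\<close>)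
    then show ?thesis by (intro exI[of _ k]) simp
  qed
  have "S \<subseteq> \<Omega>" using inR ST by auto
  then show ?thesis using that[OF x0(1) ST(1)] ST(3) key by blast
qed

end

section \<open>From the factorization to a linear isometry\<close>

lemma span_open:
  assumes "open T" "x \<in> T" shows "vec.span T = (UNIV :: (complex^'n) set)"
proof -
  have "v \<in> vec.span T" for v
  proof -
    have "\<forall>\<^sub>F t in at (0::complex). x + t *s v \<in> T"
      using assms by (intro topological_tendstoD[OF line_tendsto])
    moreover have "\<forall>\<^sub>F t in at (0::complex). t \<noteq> 0" by (simp add: eventually_at_filter)
    ultimately have "\<forall>\<^sub>F t in at (0::complex). x + t *s v \<in> T \<and> t \<noteq> 0" by eventually_elim simp
    from eventually_happens[OF this] obtain t where t: "x + t *s v \<in> T" "t \<noteq> 0" by auto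
    have "(1 / t) *s ((x + t *s v) - x) \<in> vec.span T"
      by (rule vec.span_scale[OF vec.span_diff[OF vec.span_base[OF t(1)] vec.span_base[OF assms(2)]]])
    then show ?thesis using t by simp
  qed
  then show ?thesis by auto
qed

lemma open_nonzero_set:
  assumes "continuous_on S g" "open S" shows "open {x\<in>S. g x \<noteq> (0::complex)}"
proof -
  have "{x\<in>S. g x \<noteq> 0} = S \<inter> g -` (- {0})" by auto
  then show ?thesis using continuous_open_preimage[OF assms, of "- {0}"] by auto
qed

context orth_germ begin

lemma open_not_orthogonal:
  assumes "open T" "T \<noteq> {}" "y \<noteq> 0" obtains x where "x \<in> T" "B x y \<noteq> 0"
proof -
  have "\<exists>x\<in>T. B x y \<noteq> 0"
  proof (rule ccontr)
    assume *: "\<not> ?thesis"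
    have "B x y = 0" if "x \<in> vec.span T" for x
      using that by (induction rule: vec.span_induct_alt) (use * in \<open>auto simp: src.expand src.bil.zero_left\<close>)
    then have "B x y = 0" for x using span_open[of T] assms by blast
    then show False using src.dual_vector[OF assms(3)] by auto
  qed
  then show ?thesis using that by blast
qed

text \<open>A vector in the span of the image is determined by its products with \<open>f x\<close>
  for \<open>x\<close> in an open set, so an identity between vectors can be checked on such
  products. \<open>e1\<close> and \<open>e2\<close> fix the sign of the scale factor: a negative
  factor would turn them into orthogonal vectors of positive square, against
  \<open>lorentz\<close>.\<close>

lemma local_isometry:
  assumes A: "vec.subspace A" "f ` \<Omega> \<subseteq> A"
    and lorentz: "\<And>a d. a \<in> A \<Longrightarrow> d \<in> A \<Longrightarrow> 0 < Re (B' a a) \<Longrightarrow> B' a d = 0 \<Longrightarrow> 0 \<le> Re (B' d d) \<Longrightarrow> d = 0"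
    and neg: "Re (B e1 e1) < 0" "Re (B e2 e2) < 0" "B e1 e2 = 0"
  obtains M S where "lin_isometry B B' M" "\<And>u. M *v u \<in> A" "open S" "S \<noteq> {}" "S \<subseteq> \<Omega>"
    "\<And>w. w \<in> S \<Longrightarrow> \<exists>c. f w = c *s (M *v w)"
proof -
  obtain x0 S where x0: "x0 \<in> \<Omega>" and S: "open S" "S \<noteq> {}" "S \<subseteq> \<Omega>" and
    "\<And>x. x \<in> S \<Longrightarrow> \<exists>k. \<forall>w\<in>\<Omega>. B' (f w) (f x) * B w x0 = k * B' (f w) (f x0) * B w x"
    using product_form by blast
  then obtain k where k: "\<And>x w. x \<in> S \<Longrightarrow> w \<in> \<Omega> \<Longrightarrow> B' (f w) (f x) * B w x0 = k x * B' (f w) (f x0) * B w x"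
    by metis
  define \<beta> where "\<beta> w = B' (f w) (f x0)" for w
  have nz: "x0 \<noteq> 0" using x0 zero_notin_dom by auto
  have spanA: "vec.span (f ` \<Omega>) \<subseteq> A" using A by (intro vec.span_minimal)
  \<comment> \<open>The null vector \<open>f p\<close> and \<open>f w1\<close> span a hyperbolic
    plane; \<open>\<nu>\<close> is chosen so that the mixed terms outweigh the square of
    \<open>f w1\<close>.\<close>
  obtain a where a: "a \<in> vec.span (f ` \<Omega>)" "0 < Re (B' a a)"
  proof -
    obtain w1 where w1: "w1 \<in> \<Omega>" "B' (f p) (f w1) \<noteq> 0" using generic null_point by blast
    define \<nu> where "\<nu> = complex_of_real (norm (B' (f w1) (f w1)) + 1) / B' (f p) (f w1)"
    define a where "a = f w1 + \<nu> *s f p"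
    have 1: "\<nu> * B' (f p) (f w1) = complex_of_real (norm (B' (f w1) (f w1)) + 1)" using w1 by (simp add: \<nu>_def)
    have 2: "cnj \<nu> * B' (f w1) (f p) = complex_of_real (norm (B' (f w1) (f w1)) + 1)"
      using arg_cong[OF 1, of cnj] unfolding tgt.herm_sym[of "f p" "f w1"] by simp
    have "B' (f p) (f p) = 0" using orth null_point by blast
    then have "B' a a = B' (f w1) (f w1) + 2 * complex_of_real (norm (B' (f w1) (f w1)) + 1)"
      unfolding a_def tgt.expand using 1 2 by (simp add: algebra_simps)
    then have "Re (B' a a) = Re (B' (f w1) (f w1)) + 2 * (norm (B' (f w1) (f w1)) + 1)" by simp
    then have "0 < Re (B' a a)" using abs_Re_le_cmod[of "B' (f w1) (f w1)"] by (simp add: abs_le_iff)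
    moreover have "a \<in> vec.span (f ` \<Omega>)"
      using w1 null_point unfolding a_def by (intro vec.span_add vec.span_scale vec.span_base) auto
    ultimately show ?thesis using that by blast
  qed
  \<comment> \<open>By the identity theorem \<open>d\<close> is orthogonal to the whole span, in
    particular to itself and to the positive vector \<open>a\<close>; then \<open>lorentz\<close>
    applies.\<close>
  have zero_vector: "d = 0"
    if d: "d \<in> vec.span (f ` \<Omega>)" and T: "open T" "T \<noteq> {}" "T \<subseteq> \<Omega>" "\<And>x. x \<in> T \<Longrightarrow> B' d (f x) = 0" for d T
  proof -
    have on_dom: "B' (f x) d = 0" if "x \<in> \<Omega>" for x
    proof -
      obtain t where t: "t \<in> T" using T by blast
      show ?thesis
        by (rule identity_on_lines[OF f_hol T(1) t _ _ that]) (use T t tgt.zero_iff_sym in blast)+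
    qed
    have "B' v d = 0" if "v \<in> vec.span (f ` \<Omega>)" for v
      using that by (induction rule: vec.span_induct_alt) (auto simp: on_dom tgt.expand tgt.bil.zero_left)
    then show ?thesis using lorentz[of a d] a d spanA by auto
  qed
  have cont\<beta>: "continuous_on \<Omega> \<beta>" unfolding \<beta>_def
    by (intro continuous_intros tgt.bil.continuous_on f_cont)
  have open\<beta>: "open {w\<in>\<Omega>. \<beta> w \<noteq> 0}"
    by (rule open_nonzero_set[OF cont\<beta> open_dom])
  obtain w\<beta> where w\<beta>: "w\<beta> \<in> \<Omega>" "\<beta> w\<beta> \<noteq> 0"
    using generic[OF x0] tgt.zero_iff_sym unfolding \<beta>_def by blast
  define T where "T = {w\<in>\<Omega>. \<beta> w \<noteq> 0}"
  have T: "open T" "w\<beta> \<in> T" "T \<subseteq> \<Omega>" using open\<beta> w\<beta> by (auto simp: T_def)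
  obtain b where b: "b \<subseteq> T" "vec.independent b" "T \<subseteq> vec.span b" using vec.basis_exists[of T] by metis
  have spanb: "vec.span b = UNIV"
    using vec.span_minimal[OF b(3) vec.subspace_span] span_open[OF T(1,2)] by auto
  \<comment> \<open>\<open>L\<close> is prescribed on a basis taken from \<open>T\<close> only. That
    the same formula holds, cleared of denominators, on all of the domain is
    \<open>fL\<close>.\<close>
  obtain L where L: "Vector_Spaces.linear (*s) (*s) L" "\<And>w. w \<in> b \<Longrightarrow> L w = (B w x0 / \<beta> w) *s f w"
    using vec.linear_independent_extend[OF b(2), of "\<lambda>w. (B w x0 / \<beta> w) *s f w"] by blast
  interpret L: Vector_Spaces.linear "(*s)" "(*s)" L by (rule L)
  have L_span: "L w \<in> vec.span (f ` \<Omega>)" for w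
  proof -
    have "w \<in> vec.span b" using spanb by auto
    then show ?thesis
    proof (induction rule: vec.span_induct_alt)
      case base then show ?case by (simp add: L.zero vec.span_zero)
    next
      case (step c x y)
      have "f x \<in> f ` \<Omega>" using step b T by auto
      then have "L x \<in> vec.span (f ` \<Omega>)"
        unfolding L(2)[OF step(1)] by (intro vec.span_scale vec.span_base)
      then show ?case using step by (simp add: L.add L.scale vec.span_add vec.span_scale)
    qed
  qed
  have Lf: "B' (L w) (f x) = k x * B w x" if x: "x \<in> S" for w x
  proof -
    have "w \<in> vec.span b" using spanb by auto
    then show ?thesis
    proof (induction rule: vec.span_induct_alt)
      case base then show ?case by (simp add: L.zero tgt.bil.zero_left src.bil.zero_left)
    next
      case (step c v y)
      have v: "v \<in> \<Omega>" "\<beta> v \<noteq> 0" using step b by (auto simp: T_def)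
      have "\<beta> v * B' (L v) (f x) = B v x0 * B' (f v) (f x)"
        using L(2)[OF step(1)] v by (simp add: tgt.expand)
      also have "\<dots> = \<beta> v * (k x * B v x)" using k[OF x v(1)] by (simp add: \<beta>_def mult_ac)
      finally have "B' (L v) (f x) = k x * B v x" using v by simp
      then show ?case using step by (simp add: L.add L.scale tgt.expand src.expand algebra_simps)
    qed
  qed
  have fL: "B w x0 *s f w = \<beta> w *s L w" if w: "w \<in> \<Omega>" for w
  proof -
    have "B w x0 *s f w - \<beta> w *s L w = 0"
    proof (rule zero_vector[OF _ S])
      show "B w x0 *s f w - \<beta> w *s L w \<in> vec.span (f ` \<Omega>)"
        using w L_span vec.span_base[of "f w" "f ` \<Omega>"] by (intro vec.span_diff vec.span_scale) auto
      show "B' (B w x0 *s f w - \<beta> w *s L w) (f x) = 0" if "x \<in> S" for x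
        using k[OF that w] by (simp add: tgt.expand Lf[OF that] \<beta>_def mult_ac)
    qed
    then show ?thesis by simp
  qed
  define T' where "T' = S \<inter> T"
  have "T' \<noteq> {}"
  proof
    assume "T' = {}"
    then have *: "\<beta> w = 0" if "w \<in> S" for w using that S by (auto simp: T'_def T_def)
    obtain s where "s \<in> S" using S by blast
    then have "\<beta> w\<beta> = 0"
      using identity_on_lines[of \<beta> S s w\<beta>] f_hol S * w\<beta> unfolding \<beta>_def by blast
    then show False using w\<beta> by simp
  qed
  moreover have "open T'" unfolding T'_def using S T by blast
  ultimately have T': "open T'" "T' \<noteq> {}" by auto
  define \<gamma> where "\<gamma> x = cnj (B x x0) * k x / cnj (\<beta> x)" for x
  have LL: "B' (L w) (L x) = \<gamma> x * B w x" if "x \<in> T'" for w x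
  proof -
    have x: "x \<in> S" "x \<in> \<Omega>" "\<beta> x \<noteq> 0" using that S by (auto simp: T'_def T_def)
    have "cnj (\<beta> x) * B' (L w) (L x) = B' (L w) (\<beta> x *s L x)" by (simp add: tgt.expand)
    also have "\<dots> = B' (L w) (B x x0 *s f x)" using fL[OF x(2)] by simp
    also have "\<dots> = cnj (B x x0) * (k x * B w x)" by (simp add: tgt.expand Lf[OF x(1)])
    finally show ?thesis using x by (simp add: \<gamma>_def field_simps)
  qed
  obtain x1 where x1: "x1 \<in> T'" using T' by blast
  have "x1 \<noteq> 0" using x1 S zero_notin_dom by (auto simp: T'_def)
  obtain w1 where w1: "w1 \<in> T'" "B w1 x1 \<noteq> 0" using open_not_orthogonal[OF T' \<open>x1 \<noteq> 0\<close>] by blast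
  define U where "U = {x\<in>T'. B w1 x \<noteq> 0}"
  have "continuous_on T' (\<lambda>x. B w1 x)" by (intro continuous_intros src.bil.continuous_on)
  then have "open U" unfolding U_def by (rule open_nonzero_set[OF _ T'(1)])
  \<comment> \<open>Exchanging the arguments by hermitian symmetry shows that the factor at
    \<open>x\<close> is the conjugate of the factor at \<open>w1\<close>, hence constant.\<close>
  have \<gamma>U: "\<gamma> x = cnj (\<gamma> w1)" if "x \<in> U" for x
  proof -
    have x: "x \<in> T'" "B w1 x \<noteq> 0" using that by (auto simp: U_def)
    have "\<gamma> x * B w1 x = cnj (\<gamma> w1) * B w1 x"
    proof -
      have "\<gamma> x * B w1 x = cnj (B' (L x) (L w1))"
        using LL[OF x(1), of w1] tgt.herm_sym[of "L x" "L w1"] by simp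
      also have "\<dots> = cnj (\<gamma> w1) * cnj (B x w1)" using LL[OF w1(1), of x] by simp
      also have "cnj (B x w1) = B w1 x" by (rule src.herm_sym[symmetric])
      finally show ?thesis .
    qed
    then show ?thesis using x by simp
  qed
  have LLall: "B' (L w) (L x) = cnj (\<gamma> w1) * B w x" for w x
  proof -
    have "x \<in> vec.span U" using span_open[OF \<open>open U\<close>, of x1] x1 w1 by (auto simp: U_def)
    then show ?thesis
    proof (induction rule: vec.span_induct_alt)
      case base then show ?case by (simp add: L.zero tgt.bil.zero_right src.bil.zero_right)
    next
      case (step c v y)
      have "B' (L w) (L v) = cnj (\<gamma> w1) * B w v" using \<gamma>U[OF step(1)] LL[of v w] step by (simp add: U_def)
      then show ?case using step by (simp add: L.add L.scale tgt.expand src.expand algebra_simps)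
    qed
  qed
  have "cnj (\<gamma> w1) * B w1 x1 = \<gamma> w1 * B w1 x1"
  proof -
    have "cnj (\<gamma> w1) * B w1 x1 = cnj (B' (L x1) (L w1))"
      using LLall[of w1 x1] tgt.herm_sym[of "L x1" "L w1"] by simp
    also have "\<dots> = \<gamma> w1 * cnj (B x1 w1)" using LLall[of x1 w1] by simp
    also have "cnj (B x1 w1) = B w1 x1" by (rule src.herm_sym[symmetric])
    finally show ?thesis .
  qed
  then have "cnj (\<gamma> w1) = \<gamma> w1" using w1 by simp
  then obtain r where r: "cnj (\<gamma> w1) = complex_of_real r" by (metis complex_cnj_cancel_iff Reals_cnj_iff Reals_cases)
  have iso: "B' (L w) (L x) = of_real r * B w x" for w x using LLall r by simp
  have "r \<noteq> 0"
  proof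
    assume r0: "r = 0"
    obtain x where x: "x \<in> S" "B x x0 \<noteq> 0" using open_not_orthogonal[OF S(1,2) nz] by blast
    have "continuous_on S (\<lambda>x. B x x0)" by (intro continuous_intros src.bil.continuous_on)
    then have op: "open {x\<in>S. B x x0 \<noteq> 0}"
      by (rule open_nonzero_set[OF _ S(1)])
    have L0: "L w = 0" for w
    proof (rule zero_vector[OF L_span op])
      show "B' (L w) (f y) = 0" if "y \<in> {x\<in>S. B x x0 \<noteq> 0}" for y
      proof -
        have y: "y \<in> \<Omega>" "B y x0 \<noteq> 0" using that S by auto
        have "cnj (B y x0) * B' (L w) (f y) = B' (L w) (\<beta> y *s L y)"
          using fL[OF y(1)] by (simp flip: tgt.scale_right)
        also have "\<dots> = 0" by (simp add: tgt.scale_right iso r0)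
        finally show ?thesis using y by simp
      qed
    qed (use x S in auto)
    obtain w where w: "w \<in> T" "B w x0 \<noteq> 0" using open_not_orthogonal[OF T(1) _ nz] T by blast
    then have "f w = 0" using fL[of w] L0 by (auto simp: T_def)
    then show False using w by (simp add: T_def \<beta>_def tgt.bil.zero_left)
  qed
  have "r > 0"
  proof (rule ccontr)
    assume "\<not> ?thesis"
    then have rn: "r < 0" using \<open>r \<noteq> 0\<close> by simp
    have "L e2 = 0"
    proof (rule lorentz[of "L e1"])
      show "0 < Re (B' (L e1) (L e1))" "0 \<le> Re (B' (L e2) (L e2))"
        using neg rn by (simp_all add: iso mult_neg_neg mult_nonpos_nonpos)
      show "B' (L e1) (L e2) = 0" by (simp add: iso neg)
    qed (use L_span spanA in auto)
    then have "of_real r * B e2 e2 = 0" using iso[of e2 e2] by (simp add: tgt.bil.zero_left)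
    then show False using neg rn by auto
  qed
  define L1 where "L1 w = complex_of_real (1 / sqrt r) *s L w" for w
  have L1: "Vector_Spaces.linear (*s) (*s) L1"
    by unfold_locales (simp_all add: L1_def L.add L.scale vec.scale_right_distrib vec.scale_left_commute)
  have M: "matrix L1 *v w = L1 w" for w by (rule matrix_works[OF L1])
  show ?thesis
  proof (rule that[of "matrix L1" "{x\<in>S. B x x0 \<noteq> 0}"])
    have sq: "complex_of_real (sqrt r) * complex_of_real (sqrt r) = of_real r"
      using \<open>r > 0\<close> by (simp flip: of_real_mult)
    show "lin_isometry B B' (matrix L1)"
      unfolding lin_isometry_def M L1_def tgt.expand iso using \<open>r > 0\<close> sq by (simp add: field_simps)
    show "matrix L1 *v u \<in> A" for u
      unfolding M L1_def using L_span spanA A(1) by (intro vec.subspace_scale) auto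
    have "continuous_on S (\<lambda>x. B x x0)" by (intro continuous_intros src.bil.continuous_on)
    then show "open {x\<in>S. B x x0 \<noteq> 0}"
      by (rule open_nonzero_set[OF _ S(1)])
    show "{x\<in>S. B x x0 \<noteq> 0} \<noteq> {}" using open_not_orthogonal[OF S(1,2) nz] by blast
    show "{x\<in>S. B x x0 \<noteq> 0} \<subseteq> \<Omega>" using S by auto
    fix w assume w: "w \<in> {x\<in>S. B x x0 \<noteq> 0}"
    have "f w = (\<beta> w / B w x0 * complex_of_real (sqrt r)) *s L1 w"
    proof -
      have w\<Omega>: "w \<in> \<Omega>" using w S by blast
      have "f w = (1 / B w x0) *s (B w x0 *s f w)" using w by simp
      also have "\<dots> = (1 / B w x0) *s (\<beta> w *s L w)" by (simp only: fL[OF w\<Omega>])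
      finally show ?thesis using \<open>r > 0\<close> by (simp add: L1_def)
    qed
    then show "\<exists>c. f w = c *s (matrix L1 *v w)" unfolding M by blast
  qed
qed

end

section \<open>Passing from germs to global maps\<close>

lemma parallel_if_minors_zero:
  assumes "y \<noteq> 0" "\<And>i j. x $ i * y $ j = x $ j * (y :: complex^'n) $ i"
  shows "\<exists>c. x = c *s y"
proof -
  obtain j where j: "y $ j \<noteq> 0" using assms(1) by (auto simp: vec_eq_iff)
  have "x = (x $ j / y $ j) *s y" using j assms(2)[of _ j] by (simp add: vec_eq_iff field_simps)
  then show ?thesis by blast
qed

lemma proj_local_lift:
  assumes "proj_domain U" "proj_holo U F" "p \<in> U"
  obtains r g D where "r > 0" "ball p r \<subseteq> U"
    "\<And>z. z \<in> ball p r \<Longrightarrow> (g has_derivative D z) (at z)"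
    "\<And>z c v. z \<in> ball p r \<Longrightarrow> D z (c *s v) = c *s D z v"
    "\<And>z. z \<in> ball p r \<Longrightarrow> \<exists>c. c \<noteq> 0 \<and> F z = c *s g z"
proof -
  obtain N g where N: "open N" "p \<in> N" "holo_on N g" "\<forall>z\<in>N \<inter> U. proj_eq (F z) (g z)"
    using assms unfolding proj_holo_def by blast
  obtain D where D: "\<And>z. z \<in> N \<Longrightarrow> (g has_derivative D z) (at z) \<and> (\<forall>c v. D z (c *s v) = c *s D z v)"
    using N(3) unfolding holo_on_def by metis
  have "open (N \<inter> U)" "p \<in> N \<inter> U" using N assms by (auto simp: proj_domain_def)
  then obtain r where r: "r > 0" "ball p r \<subseteq> N \<inter> U" using open_contains_ball by blast
  have "\<exists>c. c \<noteq> 0 \<and> F z = c *s g z" if "z \<in> ball p r" for z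
  proof -
    have "proj_eq (F z) (g z)" using N r that by blast
    then show ?thesis by (auto simp: proj_eq_def)
  qed
  then show ?thesis using that[of r g D] r D by blast
qed

text \<open>\<open>F\<close> is an arbitrary choice of representatives and need not be continuous,
  but a homogeneous linear relation between its coordinates survives rescaling and can be tested on
  local holomorphic lifts. The interior of the zero set then spreads over the connected
  cone.\<close>

lemma global_identity:
  fixes F :: "complex^'n \<Rightarrow> complex^'m"
  assumes U: "proj_domain U" and F: "proj_holo U F"
    and c: "\<And>i z u. (\<lambda>t. c (z + t *s u) $ i) holomorphic_on UNIV"
    and S: "open S" "S \<noteq> {}" "S \<subseteq> U" "\<And>z. z \<in> S \<Longrightarrow> (\<Sum>i\<in>UNIV. c z $ i * F z $ i) = 0"
    and z: "z \<in> U"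
  shows "(\<Sum>i\<in>UNIV. c z $ i * F z $ i) = 0"
proof -
  define Z where "Z = {z\<in>U. (\<Sum>i\<in>UNIV. c z $ i * F z $ i) = 0}"
  obtain s where s: "s \<in> S" using S by blast
  have "z \<in> interior Z"
  proof (rule connected_induction_simple[of U s z "\<lambda>z. z \<in> interior Z"])
    show "s \<in> interior Z" using S s by (auto simp: Z_def intro!: interiorI[of S])
    fix a assume a: "a \<in> U"
    obtain r g D where r: "r > 0" "ball a r \<subseteq> U"
      and D: "\<And>z. z \<in> ball a r \<Longrightarrow> (g has_derivative D z) (at z)"
        "\<And>z c v. z \<in> ball a r \<Longrightarrow> D z (c *s v) = c *s D z v"
      and g: "\<And>z. z \<in> ball a r \<Longrightarrow> \<exists>c. c \<noteq> 0 \<and> F z = c *s g z"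
      using proj_local_lift[OF U F a] by blast
    define G where "G z = (\<Sum>i\<in>UNIV. c z $ i * g z $ i)" for z
    have FG: "(\<Sum>i\<in>UNIV. c z $ i * F z $ i) = 0 \<longleftrightarrow> G z = 0" if z: "z \<in> ball a r" for z
    proof -
      obtain k where k: "k \<noteq> 0" "F z = k *s g z" using g[OF z] by blast
      have "(\<Sum>i\<in>UNIV. c z $ i * F z $ i) = k * G z"
        by (simp add: k G_def sum_distrib_left mult_ac)
      then show ?thesis using k by simp
    qed
    have g_hol: "(\<lambda>t. g (z + t *s u) $ i) holomorphic_on {t. z + t *s u \<in> ball a r}" for z u i
      by (rule holomorphic_on_line[OF open_ball, where G = "\<lambda>z. g z $ i" and DG = "\<lambda>z v. D z v $ i"])
        (use D bounded_linear.has_derivative[OF bounded_linear_vec_nth D(1)] in auto)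
    have G_hol: "(\<lambda>t. G (z + t *s u)) holomorphic_on {t. z + t *s u \<in> ball a r}" for z u
      unfolding G_def by (intro holomorphic_intros g_hol holomorphic_on_subset[OF c]) auto
    have step: "y \<in> interior Z" if x: "x \<in> ball a r" "x \<in> interior Z" and y: "y \<in> ball a r" for x y
    proof -
      have "G w = 0" if "w \<in> ball a r" for w
      proof (rule identity_on_convex[OF open_ball convex_ball G_hol open_interior x(2) x(1) _ that])
        show "G w = 0" if "w \<in> interior Z" "w \<in> ball a r" for w
          using FG[OF that(2)] interior_subset[of Z] that(1) by (auto simp: Z_def)
      qed
      then have "ball a r \<subseteq> Z" using FG r by (auto simp: Z_def)
      then show ?thesis using y by (intro interiorI[of "ball a r"]) auto
    qed
    show "\<exists>T. openin (top_of_set U) T \<and> a \<in> T \<and> (\<forall>x\<in>T. \<forall>y\<in>T. x \<in> interior Z \<longrightarrow> y \<in> interior Z)"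
    proof (intro exI[of _ "ball a r"] conjI)
      show "openin (top_of_set U) (ball a r)"
        using r U by (subst openin_open_eq) (simp_all add: proj_domain_def)
      show "a \<in> ball a r" using r by simp
      show "\<forall>x\<in>ball a r. \<forall>y\<in>ball a r. x \<in> interior Z \<longrightarrow> y \<in> interior Z"
        using step by blast
    qed
  next
    show "connected U" using U by (simp add: proj_domain_def)
    show "s \<in> U" using s S(3) by blast
    show "z \<in> U" by (rule z)
  qed
  then show ?thesis using interior_subset[of Z] by (auto simp: Z_def)
qed

section \<open>The coordinate form as a sesquilinear form\<close>

lemma bounded_bilinear_component: "bounded_bilinear (\<lambda>z w. c * (z :: complex^'k) $ i * cnj (w $ i))"
  by (rule bounded_bilinear.comp[OF bounded_bilinear_mult
        bounded_linear_compose[OF bounded_linear_mult_right bounded_linear_vec_nth]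
        bounded_linear_compose[OF bounded_linear_cnj bounded_linear_vec_nth]])

lemma bounded_bilinear_add_fun:
  assumes "bounded_bilinear f" "bounded_bilinear g"
  shows "bounded_bilinear (\<lambda>x y. f x y + g x y)"
proof -
  interpret f: bounded_bilinear f by fact
  interpret g: bounded_bilinear g by fact
  obtain K L where K: "\<And>a b. norm (f a b) \<le> norm a * norm b * K" and L: "\<And>a b. norm (g a b) \<le> norm a * norm b * L"
    using f.bounded g.bounded by blast
  show ?thesis
  proof
    show "\<exists>K. \<forall>a b. norm (f a b + g a b) \<le> norm a * norm b * K"
      using norm_triangle_mono[OF K L] by (intro exI[of _ "K + L"]) (simp add: distrib_left)
  qed (simp_all add: f.add_left f.add_right g.add_left g.add_right f.scaleR_left f.scaleR_right
        g.scaleR_left g.scaleR_right scaleR_add_right)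
qed

lemma bounded_bilinear_sum_fun:
  assumes "\<And>i. i \<in> I \<Longrightarrow> bounded_bilinear (f i)"
  shows "bounded_bilinear (\<lambda>x y. \<Sum>i\<in>I. f i x y)"
proof (cases "finite I")
  case True
  then show ?thesis using assms
  proof induction
    case empty
    show ?case by (auto simp: bounded_bilinear_def intro: exI[of _ 0])
  next
    case (insert i I)
    then show ?case by (simp add: bounded_bilinear_add_fun)
  qed
qed (auto simp: bounded_bilinear_def intro: exI[of _ 0])

lemma sesq_herm: "sesq (herm idx r s)"
proof (rule sesq.intro)
  show "bounded_bilinear (herm idx r s)"
  proof -
    have "herm idx r s = (\<lambda>z w. (\<Sum>i\<in>{i. idx i < r}. 1 * z $ i * cnj (w $ i))
        + (\<Sum>i\<in>{i. r \<le> idx i \<and> idx i < r + s}. (-1) * z $ i * cnj (w $ i)))"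
      by (simp add: herm_def fun_eq_iff sum_negf)
    then show ?thesis
      by (simp only: bounded_bilinear_add_fun bounded_bilinear_sum_fun bounded_bilinear_component)
  qed
qed (simp_all add: herm_def sum_distrib_left right_diff_distrib mult_ac)

lemma herm_axis:
  assumes "idx i < r + s"
  shows "herm idx r s z (axis i 1) = (if idx i < r then z $ i else - z $ i)"
proof -
  have "z $ j * cnj (axis i 1 $ j) = (if j = i then z $ i else 0)" for j by (simp add: axis_def)
  then show ?thesis using assms by (simp add: herm_def)
qed

lemma nondegenerate_herm:
  assumes "coord_enum idx (r + s)" shows "nondegenerate_sesq (herm idx r s)"
proof -
  interpret sesq "herm idx r s" by (rule sesq_herm)
  show ?thesis
  proof
    fix x assume x: "\<And>y. herm idx r s x y = 0"
    have "x $ i = 0" for i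
    proof -
      have "idx i < r + s" using assms by (auto simp: coord_enum_def bij_betw_def)
      then show ?thesis using herm_axis[of idx i r s x] x by (simp split: if_splits)
    qed
    then show "x = 0" by (simp add: vec_eq_iff)
  qed
qed

section \<open>Forms with one positive square and a radical\<close>

locale lorentz_form =
  fixes idx :: "'k::finite \<Rightarrow> nat" and s t :: nat
  assumes enum: "coord_enum idx (1 + s + t)"
begin

definition form :: "complex^'k \<Rightarrow> complex^'k \<Rightarrow> complex" where "form = herm idx 1 s"

sublocale sesq form unfolding form_def by (rule sesq_herm)

definition core :: "'k set" where "core = {i. idx i < 1 + s}"
definition spatial :: "'k set" where "spatial = {i. 1 \<le> idx i \<and> idx i < 1 + s}"
definition proj :: "complex^'k \<Rightarrow> complex^'k" where "proj x = (\<chi> i. if i \<in> core then x $ i else 0)"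
definition coreV :: "(complex^'k) set" where "coreV = {x. \<forall>i. i \<notin> core \<longrightarrow> x $ i = 0}"
text \<open>The radical of \<open>form\<close>, which is also the kernel of \<open>proj\<close>;
  \<open>coreV\<close> is its coordinate complement.\<close>

definition radV :: "(complex^'k) set" where "radV = {x. \<forall>i\<in>core. x $ i = 0}"
definition time :: 'k where "time = (THE i. idx i = 0)"

lemma idx_inj: "idx i = idx j \<Longrightarrow> i = j"
  using enum by (auto simp: coord_enum_def bij_betw_def inj_def)

lemma idx_ex: "n < 1 + s + t \<Longrightarrow> \<exists>i. idx i = n"
  using enum unfolding coord_enum_def bij_betw_def by (metis imageE lessThan_iff)

lemma idx_less: "idx i < 1 + s + t"
  using enum by (auto simp: coord_enum_def bij_betw_def)

lemma idx_time: "idx time = 0"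
  unfolding time_def using idx_ex[of 0] idx_inj by (metis (mono_tags, lifting) add_gr_0 less_numeral_extra(1) theI)

lemma idx_zero_iff: "idx i = 0 \<longleftrightarrow> i = time"
  using idx_time idx_inj by metis

lemma core_eq: "core = insert time spatial" "time \<notin> spatial"
proof -
  have "i \<in> core \<longleftrightarrow> i = time \<or> i \<in> spatial" for i
    using idx_zero_iff[of i] idx_time by (cases "i = time") (auto simp: core_def spatial_def)
  then show "core = insert time spatial" by auto
  show "time \<notin> spatial" by (simp add: spatial_def idx_time)
qed

lemma form_eq: "form z w = z $ time * cnj (w $ time) - (\<Sum>i\<in>spatial. z $ i * cnj (w $ i))"
proof -
  have "{i. idx i < 1} = {time}" by (auto simp: idx_zero_iff)
  then show ?thesis by (simp only: form_def herm_def spatial_def) simp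
qed

lemma Re_form: "Re (form z z) = (norm (z $ time))\<^sup>2 - (\<Sum>i\<in>spatial. (norm (z $ i))\<^sup>2)"
  by (simp add: form_eq flip: complex_norm_square)

lemma proj_core: "proj x \<in> coreV" by (simp add: proj_def coreV_def)

lemma proj_id: "x \<in> coreV \<Longrightarrow> proj x = x" by (auto simp: proj_def coreV_def vec_eq_iff)

lemma proj_rad: "x \<in> radV \<longleftrightarrow> proj x = 0" by (auto simp: proj_def radV_def vec_eq_iff)

lemma proj_diff_rad: "x - proj x \<in> radV" by (auto simp: proj_def radV_def)

lemma proj_add: "proj (x + y) = proj x + proj y" by (auto simp: proj_def vec_eq_iff)

lemma proj_scale: "proj (c *s x) = c *s proj x" by (auto simp: proj_def vec_eq_iff)

lemma proj_linear: "bounded_linear proj"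
proof -
  have "linear proj" by (rule linearI) (simp_all add: proj_add scaleR_eq_smult proj_scale)
  then show ?thesis by (simp add: linear_conv_bounded_linear)
qed

lemma form_proj: "form (proj x) y = form x y" "form x (proj y) = form x y"
proof -
  have "proj x $ i = x $ i" if "i = time \<or> i \<in> spatial" for x i
    using that core_eq by (auto simp: proj_def)
  then show "form (proj x) y = form x y" "form x (proj y) = form x y"
    by (simp_all add: form_eq cong: sum.cong)
qed

lemma subspaces: "vec.subspace coreV" "vec.subspace radV"
  by (auto simp: vec.subspace_def coreV_def radV_def)

lemma dim_core: "vec.dim coreV = 1 + s"
proof -
  have "n \<in> idx ` core" if n: "n < 1 + s" for n
  proof -
    obtain i where "idx i = n" using idx_ex[of n] n by auto
    then show ?thesis using n by (auto simp: core_def)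
  qed
  then have "idx ` core = {..<1 + s}" by (auto simp: core_def)
  moreover have "inj_on idx core" by (rule inj_onI) (rule idx_inj)
  ultimately have "bij_betw idx core {..<1 + s}" by (simp add: bij_betw_def)
  then have "card core = 1 + s" using bij_betw_same_card by fastforce
  then show ?thesis unfolding coreV_def dim_substandard_cart .
qed

lemma core_zero:
  assumes "x \<in> coreV" "0 \<le> Re (form x x)" "x $ time = 0" shows "x = 0"
proof -
  have "(\<Sum>i\<in>spatial. (norm (x $ i))\<^sup>2) \<le> 0" using assms by (simp add: Re_form)
  then have "(\<Sum>i\<in>spatial. (norm (x $ i))\<^sup>2) = 0" by (intro antisym sum_nonneg) auto
  then have "\<forall>i\<in>spatial. x $ i = 0" by (subst (asm) sum_nonneg_eq_0_iff) auto
  then have "x $ i = 0" for i using assms core_eq by (cases "i \<in> core") (auto simp: coreV_def)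
  then show ?thesis by (simp add: vec_eq_iff)
qed

text \<open>Equality of the time and spatial products of \<open>a\<close> and \<open>d\<close>
  contradicts Cauchy-Schwarz for the spatial parts, since \<open>a\<close> is strictly dominated by
  its time coordinate and \<open>d\<close> weakly by its own.\<close>

lemma reversed_cauchy_schwarz:
  assumes "d \<in> coreV" "0 < Re (form a a)" "form a d = 0" "0 \<le> Re (form d d)"
  shows "d = 0"
proof (rule core_zero[OF assms(1,4)], rule ccontr)
  assume d0: "d $ time \<noteq> 0"
  define P where "P = (\<Sum>i\<in>spatial. (norm (a $ i))\<^sup>2)"
  define Q where "Q = (\<Sum>i\<in>spatial. (norm (d $ i))\<^sup>2)"
  have P: "P < (norm (a $ time))\<^sup>2" "0 \<le> P" using assms by (auto simp: Re_form P_def intro: sum_nonneg)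
  have Q: "Q \<le> (norm (d $ time))\<^sup>2" using assms by (auto simp: Re_form Q_def)
  have "norm (a $ time) * norm (d $ time) = norm (a $ time * cnj (d $ time))" by (simp add: norm_mult)
  also have "a $ time * cnj (d $ time) = (\<Sum>i\<in>spatial. a $ i * cnj (d $ i))"
    using assms(3) by (simp add: form_eq)
  also have "norm \<dots> \<le> (\<Sum>i\<in>spatial. norm (a $ i) * norm (d $ i))"
    by (rule sum_norm_le) (simp add: norm_mult)
  finally have "(norm (a $ time) * norm (d $ time))\<^sup>2 \<le> (\<Sum>i\<in>spatial. norm (a $ i) * norm (d $ i))\<^sup>2"
    by (intro power_mono) auto
  also have "\<dots> \<le> P * Q" unfolding P_def Q_def by (rule Cauchy_Schwarz_ineq_sum)
  also have "\<dots> \<le> P * (norm (d $ time))\<^sup>2" using P Q by (intro mult_left_mono)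
  also have "\<dots> < (norm (a $ time))\<^sup>2 * (norm (d $ time))\<^sup>2" using P d0 by (intro mult_strict_right_mono) auto
  finally show False by (simp add: power_mult_distrib)
qed

text \<open>Subtracting the multiple of \<open>a\<close> that cancels the time coordinate leaves a
  null vector in the negative definite part. So null spaces inside the core are at most
  lines.\<close>

lemma null_orthogonal_parallel:
  assumes "a \<in> coreV" "d \<in> coreV" "a \<noteq> 0" "form a a = 0" "form d d = 0" "form a d = 0"
  shows "\<exists>c. d = c *s a"
proof -
  have a0: "a $ time \<noteq> 0" using core_zero[of a] assms by auto
  define d' where "d' = d - (d $ time / a $ time) *s a"
  have "form d a = 0" using assms(6) zero_iff_sym by blast
  then have "form d' d' = 0" using assms by (simp add: d'_def expand)
  moreover have "d' \<in> coreV" using assms subspaces by (simp add: d'_def vec.subspace_diff vec.subspace_scale)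
  moreover have "d' $ time = 0" using a0 by (simp add: d'_def)
  ultimately have "d' = 0" by (intro core_zero) auto
  then show ?thesis by (auto simp: d'_def)
qed

end

section \<open>The null cone as a uniqueness set\<close>

context nondegenerate_sesq begin

text \<open>The null cone is a real hypersurface: a complex line through \<open>p\<close> in a
  direction not orthogonal to \<open>p\<close> meets it in a real curve, which is enough for the
  identity theorem on that line.\<close>

lemma zero_if_zero_on_null_cone:
  assumes \<Omega>: "open \<Omega>" "convex \<Omega>" "p \<in> \<Omega>" "p \<noteq> 0" "B p p = 0"
    and G: "\<And>z u. (\<lambda>t. G (z + t *s u)) holomorphic_on {t. z + t *s u \<in> \<Omega>}"
    and null: "\<And>x. x \<in> \<Omega> \<Longrightarrow> B x x = 0 \<Longrightarrow> G x = (0::complex)"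
    and z: "z \<in> \<Omega>"
  shows "G z = 0"
proof -
  have transversal: "G z = 0" if z: "z \<in> \<Omega>" and zp: "B z p \<noteq> 0" for z
  proof (rule ccontr)
    assume "G z \<noteq> 0"
    define v where "v = z - p"
    define a where "a = B v p"
    have a: "a \<noteq> 0" using zp \<Omega> by (simp add: a_def v_def bil.diff_left)
    have "B v v = cnj (B v v)" by (rule herm_sym)
    then obtain q where q: "B v v = complex_of_real q" by (metis Reals_cnj_iff Reals_cases)
    \<comment> \<open>p + t v is null iff cnj (1/t) a + (1/t) cnj a + q = 0; the solutions 1/t form a line, so null points
      accumulate at p along this complex line\<close>
    define \<tau> where "\<tau> n = a * Complex (- q / (2 * (norm a)\<^sup>2)) (real n)" for n
    have "filterlim (\<lambda>n. norm a * real n) at_top sequentially"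
      using a by (intro filterlim_tendsto_pos_mult_at_top[OF tendsto_const] filterlim_real_sequentially) auto
    then have "filterlim (\<lambda>n. norm (\<tau> n)) at_top sequentially"
    proof (rule filterlim_at_top_mono)
      show "\<forall>\<^sub>F n in sequentially. norm a * real n \<le> norm (\<tau> n)"
        using abs_Im_le_cmod[of "Complex x (real n)" for x n]
        by (intro always_eventually allI) (simp add: \<tau>_def norm_mult mult_left_mono)
    qed
    then have \<tau>: "filterlim \<tau> at_infinity sequentially" by (rule filterlim_norm_at_top_imp_at_infinity)
    have "\<forall>\<^sub>F n in sequentially. \<tau> n \<noteq> 0"
      using eventually_gt_at_top[of 0]
    proof eventually_elim
      case (elim n)
      then have "Complex (- q / (2 * (norm a)\<^sup>2)) (real n) \<noteq> 0" by (simp add: complex_eq_iff)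
      then show ?case using a by (simp add: \<tau>_def)
    qed
    moreover have "((\<lambda>n. inverse (\<tau> n)) \<longlonglongrightarrow> 0)"
      by (rule filterlim_compose[OF tendsto_inverse_0 \<tau>])
    ultimately have lim: "filterlim (\<lambda>n. inverse (\<tau> n)) (at 0) sequentially"
      by (auto simp: filterlim_at elim: eventually_mono)
    have "\<forall>\<^sub>F t in at 0. G (p + t *s v) \<noteq> 0"
      by (rule eventually_nonzero_near_0[OF G open_line[OF \<Omega>(1)] convex_connected[OF convex_line[OF \<Omega>(2)]]])
        (use \<Omega> z \<open>G z \<noteq> 0\<close> in \<open>auto simp: v_def\<close>)
    moreover have "\<forall>\<^sub>F t in at 0. p + t *s v \<in> \<Omega>"
      using \<Omega> by (intro topological_tendstoD[OF line_tendsto]) auto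
    ultimately have "\<forall>\<^sub>F t in at 0. p + t *s v \<in> \<Omega> \<and> G (p + t *s v) \<noteq> 0" by eventually_elim simp
    from eventually_compose_filterlim[OF this lim] \<open>\<forall>\<^sub>F n in sequentially. \<tau> n \<noteq> 0\<close>
    have "\<forall>\<^sub>F n in sequentially. \<tau> n \<noteq> 0 \<and> p + inverse (\<tau> n) *s v \<in> \<Omega> \<and> G (p + inverse (\<tau> n) *s v) \<noteq> 0"
      by eventually_elim simp
    then obtain n where n: "\<tau> n \<noteq> 0" "p + inverse (\<tau> n) *s v \<in> \<Omega>" "G (p + inverse (\<tau> n) *s v) \<noteq> 0"
      using eventually_happens by fastforce
    have "cnj (\<tau> n) * a + \<tau> n * cnj a + q = 0"
    proof -
      have "cnj (\<tau> n) * a + \<tau> n * cnj a = a * cnj a * (cnj (Complex (- q / (2 * (norm a)\<^sup>2)) (real n)) + Complex (- q / (2 * (norm a)\<^sup>2)) (real n))"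
        by (simp add: \<tau>_def algebra_simps)
      also have "cnj (Complex (- q / (2 * (norm a)\<^sup>2)) (real n)) + Complex (- q / (2 * (norm a)\<^sup>2)) (real n) = of_real (- q / (norm a)\<^sup>2)"
        by (simp add: complex_eq_iff)
      also have "a * cnj a = of_real ((norm a)\<^sup>2)" by (simp flip: complex_norm_square)
      also have "complex_of_real ((norm a)\<^sup>2) * of_real (- q / (norm a)\<^sup>2) = of_real (- q)"
        using a by (simp only: flip: of_real_mult) simp
      finally show ?thesis by simp
    qed
    moreover have "\<tau> n * cnj (\<tau> n) * B (p + inverse (\<tau> n) *s v) (p + inverse (\<tau> n) *s v)
        = cnj (\<tau> n) * B v p + \<tau> n * B p v + B v v"
      using n(1) \<Omega>(5) by (simp add: expand field_simps)
    moreover have "B p v = cnj a" unfolding a_def by (rule herm_sym)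
    ultimately have "B (p + inverse (\<tau> n) *s v) (p + inverse (\<tau> n) *s v) = 0"
      using n(1) q by (simp add: a_def)
    then show False using null n by blast
  qed
  \<comment> \<open>The remaining points, those orthogonal to \<open>p\<close>, follow from the open
    set of the others, which is nonempty because of a small shift of \<open>p\<close> along
    \<open>y\<close>.\<close>
  obtain y where y: "B y p = 1" using dual_vector[OF \<Omega>(4)] by blast
  have "\<forall>\<^sub>F t in at 0. p + t *s y \<in> \<Omega>"
    using \<Omega> by (intro topological_tendstoD[OF line_tendsto]) auto
  moreover have "\<forall>\<^sub>F t in at (0::complex). t \<noteq> 0" by (simp add: eventually_at_filter)
  ultimately have "\<forall>\<^sub>F t in at 0. p + t *s y \<in> \<Omega> \<and> t \<noteq> 0" by eventually_elim simp
  from eventually_happens[OF this] obtain t where t: "p + t *s y \<in> \<Omega>" "t \<noteq> 0" by auto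
  show ?thesis
  proof (rule identity_on_convex[OF \<Omega>(1,2) G _ _ _ _ z])
    have "continuous_on \<Omega> (\<lambda>x. B x p)" by (intro continuous_intros bil.continuous_on)
    then show "open {x\<in>\<Omega>. B x p \<noteq> 0}" by (rule open_nonzero_set[OF _ \<Omega>(1)])
    show "p + t *s y \<in> {x\<in>\<Omega>. B x p \<noteq> 0}" "p + t *s y \<in> \<Omega>"
      using t \<Omega> y by (simp_all add: expand)
  qed (use transversal in blast)
qed

end

section \<open>Continuation of minors; the null and the standard alternative\<close>

lemma global_minor:
  fixes F :: "complex^'n \<Rightarrow> complex^'m"
  assumes "proj_domain U" "proj_holo U F"
    and y: "\<And>i z u. (\<lambda>t. y (z + t *s u) $ i) holomorphic_on UNIV"
    and S: "open S" "S \<noteq> {}" "S \<subseteq> U" "\<And>z. z \<in> S \<Longrightarrow> F z $ i * y z $ j = F z $ j * y z $ i"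
    and z: "z \<in> U"
  shows "F z $ i * y z $ j = F z $ j * y z $ i"
proof -
  \<comment> \<open>Pairing \<open>c z\<close> with \<open>F z\<close> gives the (i, j) minor of
    \<open>F z\<close> and \<open>y z\<close>.\<close>
  define c :: "complex^'n \<Rightarrow> complex^'m" where "c z = y z $ j *s axis i 1 - y z $ i *s axis j 1" for z
  have sum: "(\<Sum>k\<in>UNIV. c z $ k * F z $ k) = y z $ j * F z $ i - y z $ i * F z $ j" for z
  proof -
    have "c z $ k * F z $ k = (if k = i then y z $ j * F z $ k else 0) - (if k = j then y z $ i * F z $ k else 0)" for k
      by (simp add: c_def axis_def)
    then show ?thesis by (simp add: sum_subtractf)
  qed
  have "(\<Sum>k\<in>UNIV. c z $ k * F z $ k) = 0"
  proof (rule global_identity[OF assms(1,2) _ S(1-3) _ z])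
    show "(\<lambda>t. c (z + t *s u) $ k) holomorphic_on UNIV" for k z u
      by (simp add: c_def) (intro holomorphic_intros y)
    show "(\<Sum>k\<in>UNIV. c z $ k * F z $ k) = 0" if "z \<in> S" for z
      using S(4)[OF that] unfolding sum by (simp add: mult.commute)
  qed
  then show ?thesis unfolding sum by (simp add: mult.commute)
qed

context lorentz_form begin

lemma proj_nth: "proj x $ i = (if i \<in> core then x $ i else 0)"
  by (simp add: proj_def)

lemma nondegenerate_proj: "t = 0 \<Longrightarrow> proj x = x"
  using idx_less by (auto simp: proj_def core_def vec_eq_iff)

lemma core_lift:
  assumes U: "proj_domain U" "proj_holo U F" "p \<in> U"
  obtains r f D where "r > 0" "ball p r \<subseteq> U"
    "\<And>z. z \<in> ball p r \<Longrightarrow> (f has_derivative D z) (at z)"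
    "\<And>z c v. z \<in> ball p r \<Longrightarrow> D z (c *s v) = c *s D z v"
    "\<And>z. z \<in> ball p r \<Longrightarrow> \<exists>c. c \<noteq> 0 \<and> proj (F z) = c *s f z"
    "\<And>z. f z \<in> coreV"
proof -
  obtain r g D where r: "r > 0" "ball p r \<subseteq> U"
    and D: "\<And>z. z \<in> ball p r \<Longrightarrow> (g has_derivative D z) (at z)"
      "\<And>z c v. z \<in> ball p r \<Longrightarrow> D z (c *s v) = c *s D z v"
    and g: "\<And>z. z \<in> ball p r \<Longrightarrow> \<exists>c. c \<noteq> 0 \<and> F z = c *s g z"
    using proj_local_lift[OF U] by blast
  show ?thesis
  proof (rule that[OF r, of "\<lambda>z. proj (g z)" "\<lambda>z v. proj (D z v)"])
    show "((\<lambda>z. proj (g z)) has_derivative (\<lambda>v. proj (D z v))) (at z)" if "z \<in> ball p r" for z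
      by (rule bounded_linear.has_derivative[OF proj_linear D(1)[OF that]])
    show "proj (D z (c *s v)) = c *s proj (D z v)" if "z \<in> ball p r" for z c v
      by (simp add: D(2)[OF that] proj_scale)
    show "\<exists>c. c \<noteq> 0 \<and> proj (F z) = c *s proj (g z)" if "z \<in> ball p r" for z
      using g[OF that] by (metis proj_scale)
  qed (rule proj_core)
qed

text \<open>Orthogonal null vectors of the core are proportional, so the core part of
  \<open>F\<close> stays in one line, and that line together with the radical is a null space. For
  \<open>t = 0\<close> the radical is zero and the line is a single projective point.\<close>

lemma null_case:
  assumes U: "proj_domain U" "proj_holo U F" and S: "open S" "S \<noteq> {}" "S \<subseteq> U"
    and null: "\<And>z w. z \<in> S \<Longrightarrow> w \<in> S \<Longrightarrow> form (F z) (F w) = 0"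
  shows "null_map form U F \<and> (t = 0 \<longrightarrow> constant_map U F)"
proof -
  have Fnz: "F z \<noteq> 0" if "z \<in> U" for z using U that by (auto simp: proj_holo_def)
  have "\<exists>a\<in>coreV. form a a = 0 \<and> (\<forall>z\<in>U. \<exists>c. proj (F z) = c *s a)"
  proof (cases "\<exists>z1\<in>S. proj (F z1) \<noteq> 0")
    case True
    then obtain z1 where z1: "z1 \<in> S" "proj (F z1) \<noteq> 0" by blast
    define a where "a = proj (F z1)"
    have a: "a \<in> coreV" "form a a = 0" "a \<noteq> 0" using z1 null by (auto simp: a_def proj_core form_proj)
    have par: "\<exists>c. proj (F z) = c *s a" if "z \<in> S" for z
      using null z1 that a by (intro null_orthogonal_parallel) (auto simp: a_def proj_core form_proj)
    have "\<exists>c. proj (F z) = c *s a" if z: "z \<in> U" for z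
    proof (rule parallel_if_minors_zero[OF a(3)])
      show "proj (F z) $ i * a $ j = proj (F z) $ j * a $ i" for i j
      proof (cases "i \<in> core \<and> j \<in> core")
        case True
        have "F z $ i * a $ j = F z $ j * a $ i"
        proof (rule global_minor[OF U _ S _ z])
          show "F z $ i * a $ j = F z $ j * a $ i" if "z \<in> S" for z
          proof -
            obtain c where "proj (F z) = c *s a" using par[OF \<open>z \<in> S\<close>] by blast
            then have "proj (F z) $ i = c * a $ i" "proj (F z) $ j = c * a $ j" by simp_all
            then show ?thesis using True by (simp add: proj_nth)
          qed
        qed (intro holomorphic_intros)
        then show ?thesis using True by (simp add: proj_nth)
      next
        case False
        then show ?thesis using a(1) by (auto simp: proj_nth coreV_def)
      qed
    qed
    then show ?thesis using a by blast
  next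
    case False
    have "proj (F z) = 0" if z: "z \<in> U" for z
    proof -
      have "F z $ i = 0" if i: "i \<in> core" for i
      proof -
        have sum: "(\<Sum>k\<in>UNIV. axis i 1 $ k * F z $ k) = F z $ i" for z
          by (simp add: axis_def if_distrib[of "\<lambda>c. c * _"] cong: if_cong)
        have "(\<Sum>k\<in>UNIV. axis i 1 $ k * F z $ k) = 0"
        proof (rule global_identity[OF U _ S _ z])
          show "(\<Sum>k\<in>UNIV. axis i 1 $ k * F z $ k) = 0" if "z \<in> S" for z
          proof -
            have "proj (F z) $ i = 0" using False that by auto
            then show ?thesis using i by (simp add: sum proj_nth)
          qed
        qed (intro holomorphic_intros)
        then show ?thesis by (simp add: sum)
      qed
      then show ?thesis by (simp add: proj_def vec_eq_iff)
    qed
    \<comment> \<open>The witness 0 stands for maps into the radical.\<close>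
    then show ?thesis using vec.subspace_0[OF subspaces(1)]
      by (intro bexI[of _ 0]) (auto simp: bil.zero_left)
  qed
  then obtain a where a: "a \<in> coreV" "form a a = 0" and Fa: "\<And>z. z \<in> U \<Longrightarrow> \<exists>c. proj (F z) = c *s a" by blast
  define H where "H = {h. \<exists>c. proj h = c *s a}"
  have "null_map form U F"
    unfolding null_map_def
  proof (intro exI[of _ H] conjI ballI)
    show "null_space form H"
      unfolding null_space_def csubspace_def
    proof (intro conjI ballI allI)
      show "0 \<in> H" by (auto simp: H_def proj_def vec_eq_iff intro!: exI[of _ 0])
      show "u + v \<in> H" if uv: "u \<in> H" "v \<in> H" for u v
      proof -
        obtain c c' where "proj u = c *s a" "proj v = c' *s a" using uv by (auto simp: H_def)
        then have "proj (u + v) = (c + c') *s a" by (simp add: proj_add)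
        then show ?thesis unfolding H_def by blast
      qed
      show "c *s u \<in> H" if uH: "u \<in> H" for c u
      proof -
        obtain c' where "proj u = c' *s a" using uH by (auto simp: H_def)
        then have "proj (c *s u) = (c * c') *s a" by (simp add: proj_scale)
        then show ?thesis unfolding H_def by blast
      qed
      show "form u v = 0" if uv: "u \<in> H" "v \<in> H" for u v
      proof -
        obtain c c' where c: "proj u = c *s a" "proj v = c' *s a" using uv by (auto simp: H_def)
        have "form u v = form (proj u) (proj v)" by (simp only: form_proj)
        also have "\<dots> = 0" by (simp add: c expand a)
        finally show ?thesis .
      qed
    qed
    show "F z \<in> H" if "z \<in> U" for z using Fa[OF that] by (simp add: H_def)
  qed
  moreover have "constant_map U F" if t: "t = 0"
    unfolding constant_map_def
  proof (intro ballI)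
    fix z w assume zw: "z \<in> U" "w \<in> U"
    obtain c c' where c: "F z = c *s a" "F w = c' *s a" using Fa zw nondegenerate_proj[OF t] by metis
    then have "c' \<noteq> 0" using Fnz[OF zw(2)] by auto
    then have "F z = (c / c') *s F w" by (simp add: c)
    then show "proj_eq (F z) (F w)" using Fnz zw unfolding proj_eq_def by blast
  qed
  ultimately show ?thesis by blast
qed

text \<open>The decomposition is core plus radical, the second part being null by itself. For
  \<open>t = 0\<close> the radical is zero and cannot serve as a nonzero summand, but then the core
  part is all of \<open>F\<close>, which is standard.\<close>

lemma standard_case:
  assumes U: "proj_domain U" "proj_holo U F" and S: "open S" "S \<noteq> {}" "S \<subseteq> U"
    and nondeg: "nondegenerate_sesq B"
    and M: "lin_isometry B form M" "\<And>u. M *v u \<in> coreV"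
    and FM: "\<And>z. z \<in> S \<Longrightarrow> \<exists>c. proj (F z) = c *s (M *v z)"
    and z0: "z0 \<in> U" "proj (F z0) \<noteq> 0"
  shows "quasi_standard B form U F \<and> (t = 0 \<longrightarrow> standard_map B form U F)"
proof -
  interpret src: nondegenerate_sesq B by (rule nondeg)
  have Fnz: "F z \<noteq> 0" if "z \<in> U" for z using U that by (auto simp: proj_holo_def)
  have Mnz: "M *v z \<noteq> 0" if "z \<in> U" for z
  proof
    assume M0: "M *v z = 0"
    have "B z w = 0" for w using M(1) M0 unfolding lin_isometry_def by (metis bil.zero_left)
    then have "z = 0" by (rule src.nondegenerate)
    then show False using that U by (auto simp: proj_domain_def)
  qed
  have par: "\<exists>c. proj (F z) = c *s (M *v z)" if z: "z \<in> U" for z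
  proof (rule parallel_if_minors_zero[OF Mnz[OF z]])
    show "proj (F z) $ i * (M *v z) $ j = proj (F z) $ j * (M *v z) $ i" for i j
    proof (cases "i \<in> core \<and> j \<in> core")
      case True
      have "F z $ i * (M *v z) $ j = F z $ j * (M *v z) $ i"
      proof (rule global_minor[OF U _ S _ z])
        show "F z $ i * (M *v z) $ j = F z $ j * (M *v z) $ i" if "z \<in> S" for z
        proof -
          obtain c where "proj (F z) = c *s (M *v z)" using FM[OF \<open>z \<in> S\<close>] by blast
          then have "proj (F z) $ i = c * (M *v z) $ i" "proj (F z) $ j = c * (M *v z) $ j" by simp_all
          then show ?thesis using True by (simp add: proj_nth)
        qed
        show "(\<lambda>t. (M *v (z + t *s u)) $ k) holomorphic_on UNIV" for k z u
          unfolding matrix_vector_right_distrib vector_scalar_commute vector_add_component vector_smult_component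
          by (intro holomorphic_intros)
      qed
      then show ?thesis using True by (simp add: proj_nth)
    next
      case False
      then show ?thesis using M(2)[of z] by (auto simp: proj_nth coreV_def)
    qed
  qed
  have std: "standard_map B form U F" if t: "t = 0"
    unfolding standard_map_def
  proof (intro exI[of _ M] conjI ballI M(1))
    show "proj_eq (F z) (M *v z)" if "z \<in> U" for z
      using par[OF that] Fnz[OF that] Mnz[OF that] by (simp add: proj_eq_def nondegenerate_proj[OF t])
  qed
  have "quasi_standard B form U F"
  proof (cases "t = 0")
    case True
    then show ?thesis using std by (simp add: quasi_standard_def)
  next
    case False
    then obtain i0 where i0: "idx i0 = 1 + s" using idx_ex[of "1 + s"] by auto
    have "axis i0 1 \<in> radV" "axis i0 1 \<noteq> (0 :: complex^'k)"
      using i0 by (auto simp: radV_def core_def axis_def vec_eq_iff)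
    then have rad: "radV \<noteq> {0}" by blast
    have core: "coreV \<noteq> {0}" using z0 proj_core by blast
    have "x = 0" if "x \<in> coreV" "x \<in> radV" for x
      using that proj_id proj_rad by metis
    then have inter: "coreV \<inter> radV = {0}" using subspaces vec.subspace_0 by blast
    have split: "a = proj w" if "a \<in> coreV" "b \<in> radV" "w = a + b" for a b w
      using that by (simp add: proj_add proj_id proj_rad)
    have nullrad: "form a b = 0" if "b \<in> radV" for a b
      using that by (metis form_proj(2) proj_rad bil.zero_right)
    show ?thesis
      unfolding quasi_standard_def
    proof (rule disjI2, rule exI[of _ coreV], rule exI[of _ radV], rule exI[of _ M], rule exI[of _ radV], intro conjI)
      show "csubspace coreV" "csubspace radV" unfolding csubspace_iff_subspace by (rule subspaces)+
      show "\<forall>w. \<exists>a\<in>coreV. \<exists>b\<in>radV. w = a + b"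
        using proj_core proj_diff_rad by (metis add.commute diff_add_cancel)
      show "\<forall>a\<in>coreV. \<forall>b\<in>radV. form a b = 0" using nullrad by blast
      show "\<forall>u. M *v u \<in> coreV" using M(2) by blast
      show "null_space form radV" unfolding null_space_def csubspace_iff_subspace
        using subspaces nullrad by blast
      show "\<forall>z\<in>U. \<forall>a b. a \<in> coreV \<longrightarrow> b \<in> radV \<longrightarrow> F z = a + b \<longrightarrow> b \<in> radV \<and> (a \<noteq> 0 \<longrightarrow> proj_eq a (M *v z))"
        using split par Mnz unfolding proj_eq_def by metis
      show "\<exists>z\<in>U. \<exists>a b. a \<in> coreV \<and> b \<in> radV \<and> F z = a + b \<and> a \<noteq> 0"
        using z0 proj_core proj_diff_rad by (metis add.commute diff_add_cancel)
    qed (use rad core inter M in auto)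
  qed
  then show ?thesis using std by blast
qed

end

section \<open>The rigidity theorem\<close>

theorem mainTheorem13:
  fixes idx :: "'n::finite \<Rightarrow> nat" and idx' :: "'m::finite \<Rightarrow> nat"
    and s s' t' :: nat
    and U :: "(complex^'n) set" and F :: "complex^'n \<Rightarrow> complex^'m"
  assumes "coord_enum idx (1 + s)"
    and "coord_enum idx' (1 + s' + t')"
    and "local_orthogonal (herm idx 1 s) (herm idx' 1 s') U F"
    and "s' + 2 \<le> 2 * s"
  shows "(null_map (herm idx' 1 s') U F \<or> quasi_standard (herm idx 1 s) (herm idx' 1 s') U F)
       \<and> (t' = 0 \<longrightarrow> constant_map U F \<or> standard_map (herm idx 1 s) (herm idx' 1 s') U F)"
proof -
  define B where "B = herm idx 1 s"
  have ndB: "nondegenerate_sesq B" unfolding B_def using assms(1) by (rule nondegenerate_herm)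
  interpret src: nondegenerate_sesq B by (rule ndB)
  interpret tgt: lorentz_form idx' s' t' by unfold_locales (rule assms(2))
  have lo: "local_orthogonal B tgt.form U F" using assms(3) unfolding B_def tgt.form_def .
  then have U: "proj_domain U" "proj_holo U F" and orth: "\<And>x w. x \<in> U \<Longrightarrow> w \<in> U \<Longrightarrow> B x w = 0 \<Longrightarrow> tgt.form (F x) (F w) = 0"
    unfolding local_orthogonal_def by blast+
  have U0: "z \<noteq> 0" if "z \<in> U" for z using U that by (auto simp: proj_domain_def)
  have card: "CARD('n) = 1 + s"
    using bij_betw_same_card[OF assms(1)[unfolded coord_enum_def]] by simp
  obtain p0 where p0: "p0 \<in> U" "B p0 p0 = 0" using lo unfolding local_orthogonal_def by blast
  obtain r0 f D where r0: "r0 > 0" "ball p0 r0 \<subseteq> U"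
    and D: "\<And>z. z \<in> ball p0 r0 \<Longrightarrow> (f has_derivative D z) (at z)"
      "\<And>z c v. z \<in> ball p0 r0 \<Longrightarrow> D z (c *s v) = c *s D z v"
    and f: "\<And>z. z \<in> ball p0 r0 \<Longrightarrow> \<exists>c. c \<noteq> 0 \<and> tgt.proj (F z) = c *s f z"
    and f_core: "\<And>z. f z \<in> tgt.coreV"
    using tgt.core_lift[OF U p0(1)] by blast
  have form_iff: "tgt.form (f x) (f w) = 0 \<longleftrightarrow> tgt.form (F x) (F w) = 0"
    if xw: "x \<in> ball p0 r0" "w \<in> ball p0 r0" for x w
  proof -
    obtain c c' where c: "c \<noteq> 0" "tgt.proj (F x) = c *s f x" "c' \<noteq> 0" "tgt.proj (F w) = c' *s f w"
      using f xw by metis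
    have "tgt.form (F x) (F w) = tgt.form (tgt.proj (F x)) (tgt.proj (F w))" by (simp only: tgt.form_proj)
    also have "\<dots> = cnj c' * (c * tgt.form (f x) (f w))" by (simp only: c tgt.expand)
    finally show ?thesis using c by simp
  qed
  have f_hol: "(\<lambda>t. tgt.form (f (z + t *s u)) y) holomorphic_on {t. z + t *s u \<in> \<Omega>}"
    if "open \<Omega>" "\<Omega> \<subseteq> ball p0 r0" for z u y \<Omega>
    by (rule holomorphic_on_line[OF that(1), where DG = "\<lambda>x v. tgt.form (D x v) y"])
      (use that D in \<open>auto simp: subset_iff tgt.scale_left intro!: tgt.has_derivative_left\<close>)
  have "(null_map tgt.form U F \<or> quasi_standard B tgt.form U F)
       \<and> (t' = 0 \<longrightarrow> constant_map U F \<or> standard_map B tgt.form U F)"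
  \<comment> \<open>The alternative is posed at null points: if the image of each is orthogonal to
    the whole image, b vanishes for null first argument and so identically. Otherwise there is a
    null base point with the non-orthogonality that the germ argument needs.\<close>
  proof (cases "\<exists>p\<in>ball p0 r0. B p p = 0 \<and> (\<exists>w\<in>ball p0 r0. tgt.form (f p) (f w) \<noteq> 0)")
    case False
    have "tgt.form (F z) (F w) = 0" if zw: "z \<in> ball p0 r0" "w \<in> ball p0 r0" for z w
    proof -
      have "tgt.form (f z) (f w) = 0"
      proof (rule src.zero_if_zero_on_null_cone[of "ball p0 r0" p0 "\<lambda>z. tgt.form (f z) (f w)"])
        show "(\<lambda>t. tgt.form (f (z + t *s u)) (f w)) holomorphic_on {t. z + t *s u \<in> ball p0 r0}" for z u
          by (rule f_hol[OF open_ball order_refl])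
        show "tgt.form (f x) (f w) = 0" if "x \<in> ball p0 r0" "B x x = 0" for x
          using False that zw by blast
        show "p0 \<noteq> 0" by (rule U0[OF p0(1)])
      qed (use r0 p0 zw in simp_all)
      then show ?thesis using form_iff zw by blast
    qed
    then have "null_map tgt.form U F \<and> (t' = 0 \<longrightarrow> constant_map U F)"
      using r0 by (intro tgt.null_case[OF U, of "ball p0 r0"]) auto
    then show ?thesis by blast
  next
    case True
    then obtain p w1 where p: "p \<in> ball p0 r0" "B p p = 0" and w1: "w1 \<in> ball p0 r0" "tgt.form (f p) (f w1) \<noteq> 0"
      by blast
    have f_cont: "continuous_on (ball p0 r0) f"
      using D(1) by (meson continuous_at_imp_continuous_on has_derivative_continuous)
    have "open {q \<in> ball p0 r0. tgt.form (f q) (f w1) \<noteq> 0}"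
      by (intro open_nonzero_set tgt.bil.continuous_on f_cont continuous_intros) simp
    moreover have "p \<in> {q \<in> ball p0 r0. tgt.form (f q) (f w1) \<noteq> 0}" using p w1 by simp
    ultimately obtain r where r: "r > 0" "ball p r \<subseteq> {q \<in> ball p0 r0. tgt.form (f q) (f w1) \<noteq> 0}"
      using open_contains_ball by blast
    have sub: "x \<in> ball p0 r0" "x \<in> U" if "x \<in> ball p r" for x using that r r0 by blast+
    have "orth_germ B tgt.form f D (ball p r) p"
    proof (intro orth_germ.intro two_forms.intro orth_germ_axioms.intro ndB tgt.sesq_axioms)
      show "tgt.form (f x) (f w) = 0" if "x \<in> ball p r" "w \<in> ball p r" "B x w = 0" for x w
        using orth[OF sub(2)[OF that(1)] sub(2)[OF that(2)] that(3)]
          form_iff[OF sub(1)[OF that(1)] sub(1)[OF that(2)]] by blast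
      show "\<exists>\<mu>. \<mu> \<noteq> 0 \<and> f (c *s x) = \<mu> *s f x" if x: "x \<in> ball p r" "c *s x \<in> ball p r" for x c
      proof -
        have "c \<noteq> 0" using U0[OF sub(2)[OF x(2)]] by auto
        then have "proj_eq (F (c *s x)) (F x)" using U sub(2)[OF x(1)] by (auto simp: proj_holo_def)
        then obtain k where k: "F (c *s x) = k *s F x" "F (c *s x) \<noteq> 0" by (auto simp: proj_eq_def)
        then have "k \<noteq> 0" by auto
        obtain a where a: "a \<noteq> 0" "tgt.proj (F x) = a *s f x" using f[OF sub(1)[OF x(1)]] by blast
        obtain b where b: "b \<noteq> 0" "tgt.proj (F (c *s x)) = b *s f (c *s x)" using f[OF sub(1)[OF x(2)]] by blast
        have "b *s f (c *s x) = k *s (a *s f x)" using a b k by (metis tgt.proj_scale)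
        then have "(1 / b) *s (b *s f (c *s x)) = (1 / b) *s (k *s (a *s f x))" by simp
        then have "f (c *s x) = (k * a / b) *s f x" using b by simp
        then show ?thesis using a b \<open>k \<noteq> 0\<close> by (intro exI[of _ "k * a / b"]) simp
      qed
      show "vec.dim (f ` ball p r) + 3 \<le> 2 * CARD('n)"
      proof -
        have "vec.dim (f ` ball p r) \<le> vec.dim tgt.coreV" using f_core by (intro vec.dim_subset) auto
        then show ?thesis using assms(4) by (simp add: card tgt.dim_core)
      qed
      show "\<exists>w\<in>ball p r. tgt.form (f q) (f w) \<noteq> 0" if q: "q \<in> ball p r" for q
      proof (rule ccontr)
        \<comment> \<open>\<open>w1\<close> may lie outside the small ball, but orthogonality to
          \<open>f q\<close> there would spread over the large ball and reach
          \<open>w1\<close>.\<close>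
        assume *: "\<not> ?thesis"
        have "tgt.form (f w1) (f q) = 0"
        proof (rule identity_on_convex[OF open_ball convex_ball f_hol[OF open_ball order_refl] open_ball])
          show "p \<in> ball p r" "p \<in> ball p0 r0" "w1 \<in> ball p0 r0" using r p w1 by simp_all
          show "tgt.form (f w) (f q) = 0" if "w \<in> ball p r" for w
            using * that tgt.zero_iff_sym by blast
        qed
        then have "tgt.form (f q) (f w1) = 0" using tgt.zero_iff_sym by blast
        then show False using r q by blast
      qed
      show "0 \<notin> ball p r" using sub(2) U0 by blast
      show "(f has_derivative D x) (at x)" if "x \<in> ball p r" for x by (rule D(1)[OF sub(1)[OF that]])
      show "D x (c *s v) = c *s D x v" if "x \<in> ball p r" for x c v by (rule D(2)[OF sub(1)[OF that]])
    qed (use r(1) p(2) in simp_all)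
    then interpret germ: orth_germ B tgt.form f D "ball p r" p .
    \<comment> \<open>Index 0 is the positive coordinate, so indices 1 and 2 supply the two
      orthogonal negative vectors for \<open>local_isometry\<close>.\<close>
    have s2: "2 \<le> s" using germ.card_ge_3 card by simp
    obtain i1 i2 where i: "idx i1 = 1" "idx i2 = 2"
    proof -
      have "1 \<in> idx ` UNIV" "2 \<in> idx ` UNIV" using assms(1) s2 by (auto simp: coord_enum_def bij_betw_def)
      then show ?thesis using that by (metis imageE)
    qed
    then have "i1 \<noteq> i2" by auto
    have axis: "B z (axis i1 1) = - (z $ i1)" "B z (axis i2 1) = - (z $ i2)" for z
      unfolding B_def using herm_axis[of idx i1 1 s z] herm_axis[of idx i2 1 s z] i s2 by simp_all
    obtain M S where M: "lin_isometry B tgt.form M" "\<And>u. M *v u \<in> tgt.coreV"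
      and S: "open S" "S \<noteq> {}" "S \<subseteq> ball p r" "\<And>w. w \<in> S \<Longrightarrow> \<exists>c. f w = c *s (M *v w)"
    proof (rule germ.local_isometry[OF tgt.subspaces(1)])
      show "Re (B (axis i1 1) (axis i1 1)) < 0" "Re (B (axis i2 1) (axis i2 1)) < 0" "B (axis i1 1) (axis i2 1) = 0"
        unfolding axis using \<open>i1 \<noteq> i2\<close> by (simp_all add: axis_def)
      show "f ` ball p r \<subseteq> tgt.coreV" using f_core by blast
      show "d = 0" if "d \<in> tgt.coreV" "0 < Re (tgt.form a a)" "tgt.form a d = 0" "0 \<le> Re (tgt.form d d)" for a d
        using that by (rule tgt.reversed_cauchy_schwarz)
    qed (rule that)
    have "quasi_standard B tgt.form U F \<and> (t' = 0 \<longrightarrow> standard_map B tgt.form U F)"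
    proof (rule tgt.standard_case[OF U S(1,2) _ ndB M])
      show "S \<subseteq> U" using S sub by blast
      show "\<exists>c. tgt.proj (F z) = c *s (M *v z)" if zS: "z \<in> S" for z
      proof -
        obtain a where "tgt.proj (F z) = a *s f z" using f[OF sub(1)[OF subsetD[OF S(3) zS]]] by blast
        moreover obtain c where "f z = c *s (M *v z)" using S(4)[OF zS] by blast
        ultimately have "tgt.proj (F z) = (a * c) *s (M *v z)" by simp
        then show ?thesis by blast
      qed
      show "p \<in> U" using p r0 by blast
      obtain a where a: "a \<noteq> 0" "tgt.proj (F p) = a *s f p" using f[OF p(1)] by blast
      have "f p \<noteq> 0" using w1 by (auto simp: tgt.bil.zero_left)
      then show "tgt.proj (F p) \<noteq> 0" using a by simp
    qed
    then show ?thesis by blast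
  qed
  then show ?thesis unfolding B_def tgt.form_def .
qed

end
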